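(* Let $F_{-1},F_{-2},\ldots$ be operators from $\mathcal U$ to $\mathcal Y$ such that $\sum_{n=1}^\infty\|F_{-n}u\|^2<\infty$ for each $u\in\mathcal U$. Assume that the $1$-truncated Hankel operator $A:\mathcal U\to\ell^2_-(\mathcal Y)$, $Au=(\ldots,F_{-2}u,F_{-1}u)$, is a contraction. Let $H$ be a function from $\mathbf H^2(\mathcal U,\mathcal Y)$. Then the Taylor coefficients $(H_n)_{n\in\mathbb N}$ of $H$ at zero form a $1$-complementary sequence associated with $(F_{-n-1})_{n\in\mathbb N}$ if and only if there exists a Schur class function $V$ from $\mathbf S(\mathcal D_A,\mathcal Y\oplus\mathcal D_A)$ such that $$H(\lambda)=\Pi_{\mathcal Y}V(\lambda)(I-\lambda\Pi_{\mathcal D_A}V(\lambda))^{-1}D_A\qquad(\lambda\in\mathbb D).$$ Moreover, if $A$ is a strict contraction, then $\mathcal D_A=\mathcal U$.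
   Context: $\mathcal U,\mathcal Y$ are Hilbert spaces; "operator" means bounded linear operator; $\mathbb N=\{0,1,2,\ldots\}$; $\mathbb D$ is the open unit disc; $H^2(\mathcal Y)$ is the $\mathcal Y$-valued Hardy space on $\mathbb D$. $\ell^2(\mathcal Y)$ is the Hilbert space of square summable bilateral sequences $(y_n)_{n\in\mathbb Z}$ in $\mathcal Y$, and $\ell^2_-(\mathcal Y)$ the Hilbert space of square summable sequences $(\ldots,y_{-2},y_{-1})$ in $\mathcal Y$. For a contraction $A$, $D_A=(I-A^*A)^{1/2}$ and $\mathcal D_A=\overline{\operatorname{Im} D_A}$; in the claim $D_A$ is viewed as an operator from $\mathcal U$ into $\mathcal D_A$. $\Pi_{\mathcal Y}$, $\Pi_{\mathcal D_A}$ are the projections of $\mathcal Y\oplus\mathcal D_A$ onto its summands, viewed as operators into these summands. A sequence of operators $(H_n)_{n\in\mathbb N}$ from $\mathcal U$ to $\mathcal Y$ is a $1$-complementary sequence associated with $(F_{-n-1})_{n\in\mathbb N}$ if $\sum_{n=0}^\infty\|H_nu\|^2<\infty$ for each $u\in\mathcal U$ and the operator $\mathcal U\to\ell^2(\mathcal Y)$, $u\mapsto(\ldots,F_{-2}u,F_{-1}u,H_0u,H_1u,\ldots)$ (with $H_0u$ at index $0$), has operator norm at most one. $\mathbf S(\mathcal U,\mathcal Y)$ (Schur class) is the set of analytic functions on $\mathbb D$ whose values are contractions from $\mathcal U$ to $\mathcal Y$. $\mathbf H^2(\mathcal U,\mathcal Y)$ is the set of functions $F$ on $\mathbb D$ with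 values operators from $\mathcal U$ to $\mathcal Y$ such that $\lambda\mapsto F(\lambda)u$ is in $H^2(\mathcal Y)$ for each $u\in\mathcal U$. *)

theory Defs
  imports "HOL-Analysis.Analysis"
begin

section \<open>Complex Hilbert spaces\<close>

text \<open>
  A complex inner product space is presented on top of its underlying real inner product space,
  so that norm, topology, completeness, \<^const>\<open>bounded_linear\<close> and \<^const>\<open>onorm\<close> are those of the
  library. The complex inner product is linear in its first argument. Positive definiteness is
  inherited from the real inner product through \<open>inner_eq_Re_cinner\<close>.
\<close>

class complex_inner = real_inner +
  fixes scaleC :: "complex \<Rightarrow> 'a \<Rightarrow> 'a" (infixr "*\<^sub>C" 75)
    and cinner :: "'a \<Rightarrow> 'a \<Rightarrow> complex"
  assumes scaleC_add_right: "c *\<^sub>C (x + y) = c *\<^sub>C x + c *\<^sub>C y"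
    and scaleC_add_left: "(c + d) *\<^sub>C x = c *\<^sub>C x + d *\<^sub>C x"
    and scaleC_scaleC: "c *\<^sub>C d *\<^sub>C x = (c * d) *\<^sub>C x"
    and scaleR_eq_scaleC: "r *\<^sub>R x = complex_of_real r *\<^sub>C x"
    and cinner_commute: "cinner x y = cnj (cinner y x)"
    and cinner_add_left: "cinner (x + y) z = cinner x z + cinner y z"
    and cinner_scaleC_left: "cinner (c *\<^sub>C x) y = c * cinner x y"
    and inner_eq_Re_cinner: "inner x y = Re (cinner x y)"

class chilbert_space = complex_inner + complete_space

lemma scaleC_one [simp]: "1 *\<^sub>C x = (x :: 'a::complex_inner)"
  using scaleR_eq_scaleC[of 1 x] by simp

lemma scaleC_zero_left [simp]: "0 *\<^sub>C x = (0 :: 'a::complex_inner)"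
  using scaleR_eq_scaleC[of 0 x] by simp

lemma cinner_scaleC_right: "cinner x (c *\<^sub>C y) = cnj c * cinner x (y :: 'a::complex_inner)"
  by (metis cinner_commute cinner_scaleC_left complex_cnj_mult)

lemma cinner_self: "cinner x x = complex_of_real ((norm (x :: 'a::complex_inner))\<^sup>2)"
proof (rule complex_eqI)
  show "Re (cinner x x) = Re (complex_of_real ((norm x)\<^sup>2))"
    by (simp add: power2_norm_eq_inner inner_eq_Re_cinner)
  have "Im (cinner x x) = Im (cnj (cinner x x))" using cinner_commute[of x x] by simp
  then show "Im (cinner x x) = Im (complex_of_real ((norm x)\<^sup>2))" by simp
qed

lemma norm_scaleC: "norm (c *\<^sub>C x) = cmod c * norm (x :: 'a::complex_inner)"
proof -
  have "complex_of_real ((norm (c *\<^sub>C x))\<^sup>2) = c * cnj c * cinner x x"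
    by (simp only: cinner_self[symmetric] cinner_scaleC_left cinner_scaleC_right ac_simps)
  also have "\<dots> = complex_of_real ((cmod c * norm x)\<^sup>2)"
    by (simp add: cinner_self complex_norm_square[symmetric] power_mult_distrib)
  finally have "(norm (c *\<^sub>C x))\<^sup>2 = (cmod c * norm x)\<^sup>2" using of_real_eq_iff by blast
  then show ?thesis by (simp add: power2_eq_iff_nonneg)
qed

lemma Cauchy_Schwarz_cinner: "cmod (cinner x y) \<le> norm x * norm (y :: 'a::complex_inner)"
proof (cases "cinner x y = 0")
  case False
  define c where "c = cnj (cinner x y) / cmod (cinner x y)"
  have c: "cmod c = 1" using False by (simp add: c_def norm_divide)
  have "cinner (c *\<^sub>C x) y = cmod (cinner x y)"
    using False
    by (simp add: cinner_scaleC_left c_def mult.commute[of "cnj _"] complex_norm_square[symmetric]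
        power2_eq_square)
  then have "cmod (cinner x y) = inner (c *\<^sub>C x) y" by (simp add: inner_eq_Re_cinner)
  also have "\<dots> \<le> norm (c *\<^sub>C x) * norm y" by (rule norm_cauchy_schwarz)
  finally show ?thesis by (simp add: norm_scaleC c)
qed simp

instantiation complex :: chilbert_space
begin
definition scaleC_complex :: "complex \<Rightarrow> complex \<Rightarrow> complex" where "scaleC_complex c x = c * x"
definition cinner_complex :: "complex \<Rightarrow> complex \<Rightarrow> complex" where "cinner_complex x y = x * cnj y"
instance
  by standard
    (auto simp: scaleC_complex_def cinner_complex_def algebra_simps scaleR_conv_of_real inner_complex_def)
end

text \<open>The Hilbert space direct sum is the product type.\<close>

instantiation prod :: (complex_inner, complex_inner) complex_inner
begin
definition scaleC_prod :: "complex \<Rightarrow> 'a \<times> 'b \<Rightarrow> 'a \<times> 'b"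
  where "scaleC_prod c x = (c *\<^sub>C fst x, c *\<^sub>C snd x)"
definition cinner_prod :: "'a \<times> 'b \<Rightarrow> 'a \<times> 'b \<Rightarrow> complex"
  where "cinner_prod x y = cinner (fst x) (fst y) + cinner (snd x) (snd y)"
instance
proof
  fix x y :: "'a \<times> 'b"
  show "cinner x y = cnj (cinner y x)"
    by (metis cinner_prod_def cinner_commute complex_cnj_add)
qed (auto simp: scaleC_prod_def cinner_prod_def scaleC_add_right scaleC_add_left scaleC_scaleC
    scaleR_eq_scaleC cinner_add_left cinner_scaleC_left inner_eq_Re_cinner algebra_simps prod_eq_iff)
end

instance prod :: (chilbert_space, chilbert_space) chilbert_space ..


section \<open>Square summable families\<close>

typedef (overloaded) ('i, 'a) ell2 =
  "{x :: 'i \<Rightarrow> 'a::complex_inner. (\<lambda>i. (norm (x i))\<^sup>2) summable_on UNIV}"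
  by (rule exI[of _ "\<lambda>_. 0"]) simp

setup_lifting type_definition_ell2

lemma ell2_add:
  fixes x y :: "'i \<Rightarrow> 'a::real_normed_vector"
  assumes "(\<lambda>i. (norm (x i))\<^sup>2) summable_on UNIV" "(\<lambda>i. (norm (y i))\<^sup>2) summable_on UNIV"
  shows "(\<lambda>i. (norm (x i + y i))\<^sup>2) summable_on UNIV"
proof (rule summable_on_comparison_test)
  show "(\<lambda>i. 2 * (norm (x i))\<^sup>2 + 2 * (norm (y i))\<^sup>2) summable_on UNIV"
    by (intro summable_on_add summable_on_cmult_right assms)
  fix i
  have "(norm (x i + y i))\<^sup>2 \<le> (norm (x i) + norm (y i))\<^sup>2"
    by (intro power_mono norm_triangle_ineq) auto
  also have "\<dots> \<le> 2 * (norm (x i))\<^sup>2 + 2 * (norm (y i))\<^sup>2"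
    using sum_squares_bound[of "norm (x i)" "norm (y i)"] by (simp add: power2_sum)
  finally show "(norm (x i + y i))\<^sup>2 \<le> 2 * (norm (x i))\<^sup>2 + 2 * (norm (y i))\<^sup>2" .
qed auto

lemma ell2_scaleC:
  fixes x :: "'i \<Rightarrow> 'a::complex_inner"
  assumes "(\<lambda>i. (norm (x i))\<^sup>2) summable_on UNIV"
  shows "(\<lambda>i. (norm (c *\<^sub>C x i))\<^sup>2) summable_on UNIV"
  using summable_on_cmult_right[OF assms] by (simp add: norm_scaleC power_mult_distrib)

lemma ell2_cinner:
  fixes x y :: "'i \<Rightarrow> 'a::complex_inner"
  assumes "(\<lambda>i. (norm (x i))\<^sup>2) summable_on UNIV" "(\<lambda>i. (norm (y i))\<^sup>2) summable_on UNIV"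
  shows "(\<lambda>i. cinner (x i) (y i)) summable_on UNIV"
proof (rule abs_summable_summable, rule summable_on_comparison_test)
  show "(\<lambda>i. (norm (x i))\<^sup>2 + (norm (y i))\<^sup>2) summable_on UNIV"
    by (intro summable_on_add assms)
  fix i
  have "cmod (cinner (x i) (y i)) \<le> norm (x i) * norm (y i)" by (rule Cauchy_Schwarz_cinner)
  also have "\<dots> \<le> (norm (x i))\<^sup>2 + (norm (y i))\<^sup>2"
    using sum_squares_bound[of "norm (x i)" "norm (y i)"]
      mult_nonneg_nonneg[OF norm_ge_zero[of "x i"] norm_ge_zero[of "y i"]] by linarith
  finally show "norm (cinner (x i) (y i)) \<le> (norm (x i))\<^sup>2 + (norm (y i))\<^sup>2" .
qed auto

instantiation ell2 :: (type, complex_inner) complex_inner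
begin

lift_definition zero_ell2 :: "('a, 'b) ell2" is "\<lambda>_. 0" by simp
lift_definition plus_ell2 :: "('a, 'b) ell2 \<Rightarrow> ('a, 'b) ell2 \<Rightarrow> ('a, 'b) ell2"
  is "\<lambda>x y i. x i + y i" by (rule ell2_add)
lift_definition uminus_ell2 :: "('a, 'b) ell2 \<Rightarrow> ('a, 'b) ell2" is "\<lambda>x i. - x i" by simp
lift_definition minus_ell2 :: "('a, 'b) ell2 \<Rightarrow> ('a, 'b) ell2 \<Rightarrow> ('a, 'b) ell2"
  is "\<lambda>x y i. x i - y i"
  subgoal for x y using ell2_add[of x "\<lambda>i. - y i"] by simp
  done
lift_definition scaleC_ell2 :: "complex \<Rightarrow> ('a, 'b) ell2 \<Rightarrow> ('a, 'b) ell2"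
  is "\<lambda>c x i. c *\<^sub>C x i" by (rule ell2_scaleC)
lift_definition cinner_ell2 :: "('a, 'b) ell2 \<Rightarrow> ('a, 'b) ell2 \<Rightarrow> complex"
  is "\<lambda>x y. \<Sum>\<^sub>\<infinity>i. cinner (x i) (y i)" .
definition scaleR_ell2 :: "real \<Rightarrow> ('a, 'b) ell2 \<Rightarrow> ('a, 'b) ell2"
  where "scaleR_ell2 r x = complex_of_real r *\<^sub>C x"
definition inner_ell2 :: "('a, 'b) ell2 \<Rightarrow> ('a, 'b) ell2 \<Rightarrow> real"
  where "inner_ell2 x y = Re (cinner x y)"
definition norm_ell2 :: "('a, 'b) ell2 \<Rightarrow> real" where "norm_ell2 x = sqrt (inner x x)"
definition sgn_ell2 :: "('a, 'b) ell2 \<Rightarrow> ('a, 'b) ell2" where "sgn_ell2 x = inverse (norm x) *\<^sub>R x"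
definition dist_ell2 :: "('a, 'b) ell2 \<Rightarrow> ('a, 'b) ell2 \<Rightarrow> real" where "dist_ell2 x y = norm (x - y)"
definition uniformity_ell2 :: "(('a, 'b) ell2 \<times> ('a, 'b) ell2) filter"
  where "uniformity_ell2 = (INF e\<in>{0<..}. principal {(x, y). dist x y < e})"
definition open_ell2 :: "('a, 'b) ell2 set \<Rightarrow> bool"
  where "open_ell2 U = (\<forall>x\<in>U. eventually (\<lambda>(x', y). x' = x \<longrightarrow> y \<in> U) uniformity)"

lemma cinner_self_ell2:
  "cinner x x = complex_of_real (\<Sum>\<^sub>\<infinity>i. (norm (Rep_ell2 x i))\<^sup>2)" for x :: "('a, 'b) ell2"
  unfolding cinner_ell2.rep_eq cinner_self
  by (rule infsumI, rule has_sum_bounded_linear[OF bounded_linear_of_real])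
    (use Rep_ell2[of x] in \<open>simp add: has_sum_infsum\<close>)

instance
proof
  fix x y z :: "('a, 'b) ell2" and r s :: real and c d :: complex
  show "x + y + z = x + (y + z)" by transfer (simp add: add.assoc)
  show "x + y = y + x" by transfer (simp add: add.commute)
  show "0 + x = x" by transfer simp
  show "- x + x = 0" by transfer simp
  show "x - y = x + - y" by transfer simp
  show radd: "c *\<^sub>C (x + y) = c *\<^sub>C x + c *\<^sub>C y" for c and x y :: "('a, 'b) ell2"
    by transfer (simp add: scaleC_add_right)
  show ladd: "(c + d) *\<^sub>C x = c *\<^sub>C x + d *\<^sub>C x" for c d and x :: "('a, 'b) ell2"
    by transfer (simp add: scaleC_add_left)
  show mul: "c *\<^sub>C d *\<^sub>C x = (c * d) *\<^sub>C x" for c d and x :: "('a, 'b) ell2"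
    by transfer (simp add: scaleC_scaleC)
  show "r *\<^sub>R x = complex_of_real r *\<^sub>C x" by (simp add: scaleR_ell2_def)
  show "r *\<^sub>R (x + y) = r *\<^sub>R x + r *\<^sub>R y" by (simp add: scaleR_ell2_def radd)
  show "(r + s) *\<^sub>R x = r *\<^sub>R x + s *\<^sub>R x" by (simp add: scaleR_ell2_def ladd)
  show "r *\<^sub>R s *\<^sub>R x = (r * s) *\<^sub>R x" by (simp add: scaleR_ell2_def mul)
  show "1 *\<^sub>R x = x" unfolding scaleR_ell2_def by transfer simp
  show "sgn x = inverse (norm x) *\<^sub>R x" by (rule sgn_ell2_def)
  show "dist x y = norm (x - y)" by (rule dist_ell2_def)
  show "uniformity = (INF e\<in>{0<..}. principal {(x :: ('a, 'b) ell2, y). dist x y < e})"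
    by (rule uniformity_ell2_def)
  show "open U = (\<forall>x\<in>U. eventually (\<lambda>(x', y). x' = x \<longrightarrow> y \<in> U) uniformity)"
    for U :: "('a, 'b) ell2 set" by (rule open_ell2_def)
  show com: "cinner x y = cnj (cinner y x)" for x y :: "('a, 'b) ell2"
  proof transfer
    fix x y :: "'a \<Rightarrow> 'b"
    have "(\<Sum>\<^sub>\<infinity>i. cinner (x i) (y i)) = (\<Sum>\<^sub>\<infinity>i. cnj (cinner (y i) (x i)))"
      by (intro infsum_cong) (rule cinner_commute)
    then show "(\<Sum>\<^sub>\<infinity>i. cinner (x i) (y i)) = cnj (\<Sum>\<^sub>\<infinity>i. cinner (y i) (x i))" by simp
  qed
  show add: "cinner (x + y) z = cinner x z + cinner y z" for x y z :: "('a, 'b) ell2"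
    by transfer (simp add: cinner_add_left infsum_add ell2_cinner)
  show scale: "cinner (c *\<^sub>C x) y = c * cinner x y" for c and x y :: "('a, 'b) ell2"
    by transfer (simp add: cinner_scaleC_left infsum_cmult_right')
  show "inner x y = Re (cinner x y)" by (rule inner_ell2_def)
  show "inner x y = inner y x" unfolding inner_ell2_def by (subst com) simp
  show "inner (x + y) z = inner x z + inner y z" by (simp add: inner_ell2_def add)
  show "inner (r *\<^sub>R x) y = r * inner x y" by (simp add: inner_ell2_def scaleR_ell2_def scale)
  show "0 \<le> inner x x" by (simp add: inner_ell2_def cinner_self_ell2 infsum_nonneg)
  show "inner x x = 0 \<longleftrightarrow> x = 0"
  proof
    assume "inner x x = 0"
    then have "(\<Sum>\<^sub>\<infinity>i. (norm (Rep_ell2 x i))\<^sup>2) = 0"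
      by (simp add: inner_ell2_def cinner_self_ell2)
    then have "(norm (Rep_ell2 x i))\<^sup>2 = 0" for i
      using nonneg_infsum_le_0D[of "\<lambda>i. (norm (Rep_ell2 x i))\<^sup>2" UNIV i] Rep_ell2[of x] by simp
    then show "x = 0" by (simp add: Rep_ell2_inject[symmetric] zero_ell2.rep_eq fun_eq_iff)
  qed (simp add: inner_ell2_def cinner_self_ell2 zero_ell2.rep_eq)
  show "norm x = sqrt (inner x x)" by (rule norm_ell2_def)
qed

end

lemma norm_ell2_sq: "(norm x)\<^sup>2 = (\<Sum>\<^sub>\<infinity>i. (norm (Rep_ell2 x i))\<^sup>2)"
proof -
  have "(norm x)\<^sup>2 = inner x x" by (simp add: power2_norm_eq_inner)
  also have "\<dots> = (\<Sum>\<^sub>\<infinity>i. (norm (Rep_ell2 x i))\<^sup>2)" by (simp add: inner_ell2_def cinner_self_ell2)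
  finally show ?thesis .
qed

lemma sum_Rep_ell2_le:
  assumes "finite I"
  shows "(\<Sum>i\<in>I. (norm (Rep_ell2 x i))\<^sup>2) \<le> (norm x)\<^sup>2"
  unfolding norm_ell2_sq
  by (rule finite_sum_le_infsum) (use Rep_ell2[of x] assms in auto)

lemma norm_Rep_ell2_le: "norm (Rep_ell2 x i) \<le> norm x"
  using sum_Rep_ell2_le[of "{i}" x] by (simp add: power2_le_iff_abs_le)

instance ell2 :: (type, chilbert_space) chilbert_space
proof
  fix X :: "nat \<Rightarrow> ('a, 'b) ell2"
  assume X: "Cauchy X"
  have "Cauchy (\<lambda>n. Rep_ell2 (X n) i)" for i
  proof (rule CauchyI)
    fix e :: real assume "0 < e"
    then obtain M where M: "\<And>m n. m \<ge> M \<Longrightarrow> n \<ge> M \<Longrightarrow> norm (X m - X n) < e"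
      using CauchyD[OF X] by blast
    have "norm (Rep_ell2 (X m) i - Rep_ell2 (X n) i) \<le> norm (X m - X n)" for m n
      using norm_Rep_ell2_le[of "X m - X n" i] by (simp add: minus_ell2.rep_eq)
    then show "\<exists>M. \<forall>m\<ge>M. \<forall>n\<ge>M. norm (Rep_ell2 (X m) i - Rep_ell2 (X n) i) < e"
      using M by (meson le_less_trans)
  qed
  then have "\<forall>i. \<exists>l. (\<lambda>n. Rep_ell2 (X n) i) \<longlonglongrightarrow> l"
    using Cauchy_convergent convergent_def by blast
  then obtain l where l: "\<And>i. (\<lambda>n. Rep_ell2 (X n) i) \<longlonglongrightarrow> l i" by metis
  have tail: "\<exists>M. \<forall>m\<ge>M. \<forall>I. finite I \<longrightarrow> (\<Sum>i\<in>I. (norm (Rep_ell2 (X m) i - l i))\<^sup>2) \<le> e\<^sup>2"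
    if e: "0 < e" for e
  proof -
    obtain M where M: "\<And>m n. m \<ge> M \<Longrightarrow> n \<ge> M \<Longrightarrow> norm (X m - X n) < e"
      using CauchyD[OF X e] by blast
    have "(\<Sum>i\<in>I. (norm (Rep_ell2 (X m) i - l i))\<^sup>2) \<le> e\<^sup>2" if m: "m \<ge> M" and I: "finite I" for m I
    proof (rule LIMSEQ_le_const2)
      show "(\<lambda>n. \<Sum>i\<in>I. (norm (Rep_ell2 (X m) i - Rep_ell2 (X n) i))\<^sup>2)
          \<longlonglongrightarrow> (\<Sum>i\<in>I. (norm (Rep_ell2 (X m) i - l i))\<^sup>2)"
        by (intro tendsto_intros l)
      have "(\<Sum>i\<in>I. (norm (Rep_ell2 (X m) i - Rep_ell2 (X n) i))\<^sup>2) \<le> e\<^sup>2" if "n \<ge> M" for n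
      proof -
        have "(\<Sum>i\<in>I. (norm (Rep_ell2 (X m) i - Rep_ell2 (X n) i))\<^sup>2) \<le> (norm (X m - X n))\<^sup>2"
          using sum_Rep_ell2_le[OF I, of "X m - X n"] by (simp add: minus_ell2.rep_eq)
        also have "\<dots> \<le> e\<^sup>2" using M[OF m that] by (intro power_mono) auto
        finally show ?thesis .
      qed
      then show "\<exists>N. \<forall>n\<ge>N. (\<Sum>i\<in>I. (norm (Rep_ell2 (X m) i - Rep_ell2 (X n) i))\<^sup>2) \<le> e\<^sup>2" by blast
    qed
    then show ?thesis by blast
  qed
  obtain M where M: "\<And>I. finite I \<Longrightarrow> (\<Sum>i\<in>I. (norm (Rep_ell2 (X M) i - l i))\<^sup>2) \<le> 1\<^sup>2"
    using tail[of 1] by auto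
  have "(\<lambda>i. (norm (l i - Rep_ell2 (X M) i))\<^sup>2) summable_on UNIV"
    by (rule nonneg_bdd_above_summable_on)
      (use M in \<open>auto simp: bdd_above_def norm_minus_commute\<close>)
  from ell2_add[OF this, of "Rep_ell2 (X M)"] Rep_ell2[of "X M"]
  have "(\<lambda>i. (norm (l i))\<^sup>2) summable_on UNIV" by simp
  then have L: "Rep_ell2 (Abs_ell2 l) = l" by (simp add: Abs_ell2_inverse)
  have "X \<longlonglongrightarrow> Abs_ell2 l"
  proof (rule metric_LIMSEQ_I)
    fix e :: real assume e: "0 < e"
    then obtain M where M: "\<And>m I. m \<ge> M \<Longrightarrow> finite I \<Longrightarrow>
        (\<Sum>i\<in>I. (norm (Rep_ell2 (X m) i - l i))\<^sup>2) \<le> (e/2)\<^sup>2"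
      using tail[of "e/2"] by auto
    have "dist (X m) (Abs_ell2 l) < e" if "m \<ge> M" for m
    proof -
      have "(norm (X m - Abs_ell2 l))\<^sup>2 \<le> (e/2)\<^sup>2"
        unfolding norm_ell2_sq
      proof (rule infsum_le_finite_sums)
        show "(\<lambda>i. (norm (Rep_ell2 (X m - Abs_ell2 l) i))\<^sup>2) summable_on UNIV"
          using Rep_ell2[of "X m - Abs_ell2 l"] by simp
        show "(\<Sum>i\<in>I. (norm (Rep_ell2 (X m - Abs_ell2 l) i))\<^sup>2) \<le> (e/2)\<^sup>2" if "finite I" for I
          using M[OF \<open>m \<ge> M\<close> that] by (simp add: minus_ell2.rep_eq L)
      qed
      then have "norm (X m - Abs_ell2 l) \<le> e/2" using e by (simp add: power2_le_iff_abs_le)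
      then show ?thesis using e by (simp add: dist_norm)
    qed
    then show "\<exists>M. \<forall>m\<ge>M. dist (X m) (Abs_ell2 l) < e" by blast
  qed
  then show "convergent X" by (rule convergentI)
qed


section \<open>Operators\<close>

definition bounded_clinear :: "('a::complex_inner \<Rightarrow> 'b::complex_inner) \<Rightarrow> bool" where
  "bounded_clinear T \<longleftrightarrow> bounded_linear T \<and> (\<forall>c x. T (c *\<^sub>C x) = c *\<^sub>C T x)"

definition contraction :: "('a::complex_inner \<Rightarrow> 'b::complex_inner) \<Rightarrow> bool" where
  "contraction T \<longleftrightarrow> bounded_clinear T \<and> onorm T \<le> 1"

definition cadjoint :: "('a::complex_inner \<Rightarrow> 'b::complex_inner) \<Rightarrow> 'b \<Rightarrow> 'a" where
  "cadjoint T = (THE S. \<forall>x y. cinner (T x) y = cinner x (S y))"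

definition positive_op :: "('a::complex_inner \<Rightarrow> 'a) \<Rightarrow> bool" where
  "positive_op T \<longleftrightarrow> bounded_clinear T \<and> (\<forall>x. cinner (T x) x \<in> \<real> \<and> 0 \<le> Re (cinner (T x) x))"

definition sqrt_op :: "('a::complex_inner \<Rightarrow> 'a) \<Rightarrow> 'a \<Rightarrow> 'a" where
  "sqrt_op T = (THE S. positive_op S \<and> S \<circ> S = T)"

definition defect_op :: "('a::complex_inner \<Rightarrow> 'b::complex_inner) \<Rightarrow> 'a \<Rightarrow> 'a" where
  "defect_op A = sqrt_op (\<lambda>x. x - cadjoint A (A x))"

definition defect_space :: "('a::complex_inner \<Rightarrow> 'b::complex_inner) \<Rightarrow> 'a set" where
  "defect_space A = closure (range (defect_op A))"

text \<open>
  The space \<^const>\<open>defect_space\<close> depends on a term and is therefore not a type. Operators from a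
  closed subspace \<open>S\<close> into a closed subspace \<open>R\<close> are functions on the ambient types of which only the
  restriction to \<open>S\<close> matters.
\<close>

definition bounded_clinear_on ::
    "'a::complex_inner set \<Rightarrow> 'b::complex_inner set \<Rightarrow> ('a \<Rightarrow> 'b) \<Rightarrow> bool" where
  "bounded_clinear_on S R T \<longleftrightarrow> T ` S \<subseteq> R
     \<and> (\<forall>x\<in>S. \<forall>y\<in>S. T (x + y) = T x + T y) \<and> (\<forall>c. \<forall>x\<in>S. T (c *\<^sub>C x) = c *\<^sub>C T x)
     \<and> (\<exists>K. \<forall>x\<in>S. norm (T x) \<le> K * norm x)"

definition onorm_on :: "'a::complex_inner set \<Rightarrow> ('a \<Rightarrow> 'b::complex_inner) \<Rightarrow> real" where
  "onorm_on S T = (SUP x\<in>S. norm (T x) / norm x)"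

definition contraction_on ::
    "'a::complex_inner set \<Rightarrow> 'b::complex_inner set \<Rightarrow> ('a \<Rightarrow> 'b) \<Rightarrow> bool" where
  "contraction_on S R T \<longleftrightarrow> bounded_clinear_on S R T \<and> onorm_on S T \<le> 1"

lemma bounded_clinear_on_UNIV: "bounded_clinear_on UNIV UNIV T \<longleftrightarrow> bounded_clinear T"
proof
  assume *: "bounded_clinear_on UNIV UNIV T"
  have "bounded_linear T"
    unfolding bounded_linear_def linear_iff bounded_linear_axioms_def
    using * by (auto simp: bounded_clinear_on_def scaleR_eq_scaleC mult.commute)
  then show "bounded_clinear T" using * by (simp add: bounded_clinear_def bounded_clinear_on_def)
next
  assume *: "bounded_clinear T"
  then obtain K where "\<forall>x. norm (T x) \<le> norm x * K"
    using bounded_linear.bounded[of T] by (auto simp: bounded_clinear_def)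
  with * show "bounded_clinear_on UNIV UNIV T"
    by (auto simp: bounded_clinear_def bounded_clinear_on_def mult.commute
        linear_simps intro!: exI[of _ K])
qed

lemma contraction_on_UNIV: "contraction_on UNIV UNIV T \<longleftrightarrow> contraction T"
  by (simp add: contraction_on_def contraction_def bounded_clinear_on_UNIV onorm_on_def onorm_def)

text \<open>
  By the following lemma, \<^const>\<open>inv_into\<close> gives the genuine inverse of \<open>I - z \<Pi> V\<close> on the subspace, where \<open>\<Pi>\<close> is the
  second projection of a direct sum.
\<close>

lemma bij_betw_resolvent:
  fixes T :: "'a::chilbert_space \<Rightarrow> 'b::complex_inner \<times> 'a"
  assumes S: "closed S" "0 \<in> S" "\<And>x y. x \<in> S \<Longrightarrow> y \<in> S \<Longrightarrow> x + y \<in> S"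
      "\<And>c x. x \<in> S \<Longrightarrow> c *\<^sub>C x \<in> S"
    and T: "contraction_on S (R \<times> S) T" and z: "z \<in> ball 0 1"
  shows "bij_betw (\<lambda>x. x - z *\<^sub>C snd (T x)) S S"
proof -
  have neg: "(- 1) *\<^sub>C x = - x" for x :: 'a
    using scaleR_eq_scaleC[of "- 1" x] by simp
  have diff: "x - y \<in> S" if "x \<in> S" "y \<in> S" for x y
    using S(3)[OF that(1) S(4)[OF that(2), of "- 1"]] by (simp add: neg)
  have TS: "snd (T x) \<in> S" if "x \<in> S" for x
    using T that by (fastforce simp: contraction_on_def bounded_clinear_on_def)
  obtain K where K: "\<forall>x\<in>S. norm (T x) \<le> K * norm x"
    using T by (auto simp: contraction_on_def bounded_clinear_on_def)
  have le: "norm (T x) \<le> norm x" if x: "x \<in> S" for x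
  proof (cases "x = 0")
    case True
    then show ?thesis using K x by force
  next
    case False
    have "bdd_above ((\<lambda>x. norm (T x) / norm x) ` S)"
    proof (rule bdd_aboveI2)
      fix x assume "x \<in> S"
      then show "norm (T x) / norm x \<le> max K 0"
        using K by (cases "x = 0") (auto simp: divide_le_eq le_max_iff_disj)
    qed
    then have "norm (T x) / norm x \<le> onorm_on S T"
      unfolding onorm_on_def by (rule cSUP_upper[OF x])
    also have "\<dots> \<le> 1" using T by (simp add: contraction_on_def)
    finally show ?thesis using False by (simp add: divide_le_eq)
  qed
  have snd_diff: "snd (T x) - snd (T y) = snd (T (x - y))" if "x \<in> S" "y \<in> S" for x y
  proof -
    have "T ((x - y) + y) = T (x - y) + T y"
      using T diff[OF that] that(2) unfolding contraction_on_def bounded_clinear_on_def by blast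
    then show ?thesis by simp
  qed
  have Lip: "dist (y + z *\<^sub>C snd (T a)) (y + z *\<^sub>C snd (T b)) \<le> cmod z * dist a b"
    if ab: "a \<in> S" "b \<in> S" for y a b
  proof -
    have "z *\<^sub>C snd (T b) + z *\<^sub>C (snd (T a) - snd (T b)) = z *\<^sub>C snd (T a)"
      unfolding scaleC_add_right[symmetric] by simp
    then have "z *\<^sub>C snd (T a) - z *\<^sub>C snd (T b) = z *\<^sub>C (snd (T a) - snd (T b))"
      by (metis add_diff_cancel_left')
    then have "dist (y + z *\<^sub>C snd (T a)) (y + z *\<^sub>C snd (T b)) = norm (z *\<^sub>C snd (T (a - b)))"
      by (simp add: dist_norm snd_diff[OF ab])
    also have "\<dots> \<le> cmod z * norm (a - b)"
      unfolding norm_scaleC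
      using le[OF diff[OF ab]] norm_snd_le[of "snd (T (a - b))" "fst (T (a - b))"]
      by (intro mult_left_mono) auto
    finally show ?thesis by (simp add: dist_norm)
  qed
  have ex1: "\<exists>!x\<in>S. y + z *\<^sub>C snd (T x) = x" if y: "y \<in> S" for y
  proof (rule Banach_fix)
    show "complete S" using S(1) by (rule complete_eq_closed[THEN iffD2])
    show "(\<lambda>x. y + z *\<^sub>C snd (T x)) ` S \<subseteq> S" using S(3,4) TS y by blast
    show "dist (y + z *\<^sub>C snd (T a)) (y + z *\<^sub>C snd (T b)) \<le> cmod z * dist a b"
      if "a \<in> S" "b \<in> S" for a b using Lip[OF that] .
  qed (use S(2) z in auto)
  have eq: "x - z *\<^sub>C snd (T x) = y \<longleftrightarrow> y + z *\<^sub>C snd (T x) = x" for x y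
    by (auto simp: algebra_simps)
  show ?thesis
    unfolding bij_betw_def
  proof
    show "inj_on (\<lambda>x. x - z *\<^sub>C snd (T x)) S"
    proof (rule inj_onI)
      fix a b
      assume ab: "a \<in> S" "b \<in> S" and "a - z *\<^sub>C snd (T a) = b - z *\<^sub>C snd (T b)"
      then have "b - z *\<^sub>C snd (T b) + z *\<^sub>C snd (T a) = a" by (simp add: eq)
      moreover have "b - z *\<^sub>C snd (T b) + z *\<^sub>C snd (T b) = b" by simp
      ultimately show "a = b"
        using ex1[OF diff[OF ab(2) S(4)[OF TS[OF ab(2)]]]] ab by blast
    qed
    show "(\<lambda>x. x - z *\<^sub>C snd (T x)) ` S = S"
    proof
      show "(\<lambda>x. x - z *\<^sub>C snd (T x)) ` S \<subseteq> S" using diff S(4) TS by blast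
      show "S \<subseteq> (\<lambda>x. x - z *\<^sub>C snd (T x)) ` S"
      proof
        fix y assume "y \<in> S"
        from ex1[OF this] obtain x where x: "x \<in> S" "y + z *\<^sub>C snd (T x) = x" by blast
        then have "y = x - z *\<^sub>C snd (T x)" using eq by metis
        with x(1) show "y \<in> (\<lambda>x. x - z *\<^sub>C snd (T x)) ` S" by blast
      qed
    qed
  qed
qed


section \<open>Analytic functions on the open unit disc\<close>

definition has_cderiv ::
    "(complex \<Rightarrow> 'a::complex_inner) \<Rightarrow> 'a \<Rightarrow> complex \<Rightarrow> bool" where
  "has_cderiv f D z \<longleftrightarrow> ((\<lambda>w. inverse (w - z) *\<^sub>C (f w - f z)) \<longlongrightarrow> D) (at z)"

lemma has_cderiv_unique: "has_cderiv f D z \<Longrightarrow> has_cderiv f E z \<Longrightarrow> D = E"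
  unfolding has_cderiv_def by (rule tendsto_unique[OF at_neq_bot])

definition cderiv :: "(complex \<Rightarrow> 'a::complex_inner) \<Rightarrow> complex \<Rightarrow> 'a" where
  "cderiv f z = (THE D. has_cderiv f D z)"

definition taylor_coeff :: "(complex \<Rightarrow> 'a::complex_inner) \<Rightarrow> nat \<Rightarrow> 'a" where
  "taylor_coeff f n = inverse (fact n) *\<^sub>C (cderiv ^^ n) f 0"

definition hardy2 :: "(complex \<Rightarrow> 'a::complex_inner) set" where
  "hardy2 = {f. (\<forall>z\<in>ball 0 1. \<exists>D. has_cderiv f D z)
     \<and> (\<exists>M. \<forall>r\<in>{0..<1}.
          1 / (2 * pi) * integral {0..2 * pi} (\<lambda>t. (norm (f (complex_of_real r * cis t)))\<^sup>2) \<le> M)}"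

definition hardy2_op :: "(complex \<Rightarrow> 'a::complex_inner \<Rightarrow> 'b::complex_inner) set" where
  "hardy2_op = {F. (\<forall>z\<in>ball 0 1. bounded_clinear (F z)) \<and> (\<forall>u. (\<lambda>z. F z u) \<in> hardy2)}"

text \<open>Analyticity of an operator valued function refers to the operator norm.\<close>

definition schur_class ::
    "'a::complex_inner set \<Rightarrow> 'b::complex_inner set \<Rightarrow> (complex \<Rightarrow> 'a \<Rightarrow> 'b) set" where
  "schur_class S R = {V. (\<forall>z\<in>ball 0 1. contraction_on S R (V z))
     \<and> (\<forall>z\<in>ball 0 1. \<exists>L. bounded_clinear_on S R L \<and>
          ((\<lambda>w. onorm_on S (\<lambda>x. inverse (w - z) *\<^sub>C (V w x - V z x) - L x)) \<longlongrightarrow> 0) (at z))}"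


section \<open>Hankel operators and complementary sequences\<close>

text \<open>
  Here \<open>F :: int \<Rightarrow> _\<close> is only used at negative indices. The space of square summable sequences
  \<open>(\<dots>, y\<^sub>-\<^sub>2, y\<^sub>-\<^sub>1)\<close> is \<open>(nat, 'y) ell2\<close>, with \<open>y\<^sub>-\<^sub>n\<^sub>-\<^sub>1\<close> stored at position \<open>n\<close>.
\<close>

definition truncated_hankel ::
    "(int \<Rightarrow> 'u::complex_inner \<Rightarrow> 'y::complex_inner) \<Rightarrow> 'u \<Rightarrow> (nat, 'y) ell2" where
  "truncated_hankel F u = Abs_ell2 (\<lambda>n. F (- int n - 1) u)"

text \<open>
  The first two conjuncts, together with square summability of \<open>F (-1) u, F (-2) u, \<dots>\<close>, ensure that
  \<^const>\<open>Abs_ell2\<close> is applied to a square summable bilateral sequence.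
\<close>

definition one_complementary ::
    "(int \<Rightarrow> 'u::complex_inner \<Rightarrow> 'y::complex_inner) \<Rightarrow> (nat \<Rightarrow> 'u \<Rightarrow> 'y) \<Rightarrow> bool" where
  "one_complementary F H \<longleftrightarrow> (\<forall>n. bounded_clinear (H n))
     \<and> (\<forall>u. summable (\<lambda>n. (norm (H n u))\<^sup>2))
     \<and> contraction (\<lambda>u. Abs_ell2 (\<lambda>k::int. if k < 0 then F k u else H (nat k) u) :: (int, 'y) ell2)"

end

theory Submission
  imports Defs "HOL-Complex_Analysis.Cauchy_Integral_Formula"
begin

text \<open>
  The sequence \<open>(H\<^sub>n)\<close> is complementary iff \<open>\<Sum>\<^sub>n (norm (H\<^sub>n u))\<^sup>2 \<le> (norm (D\<^sub>A u))\<^sup>2\<close> for all \<open>u\<close>.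
  Given such a sequence, Douglas' lemma yields a contraction \<open>\<Gamma>\<close> with \<open>\<Gamma> (D\<^sub>A u) = (H\<^sub>n u)\<^sub>n\<close>, whence
  \<open>H(z) = E (I - z T)\<^sup>-\<^sup>1 \<Gamma> D\<^sub>A\<close> for the backward shift \<open>T\<close> and the evaluation \<open>E\<close> at position 0;
  feeding back \<open>\<Gamma>\<^sup>* T\<close> turns this realization into one of a Schur function \<open>V\<close>. Conversely, given
  \<open>V\<close>, put \<open>h(z) = (I - z \<Pi> V(z))\<^sup>-\<^sup>1 D\<^sub>A u\<close> and compare the means over circles of the two sides
  of \<open>(norm (V(z) h(z)))\<^sup>2 \<le> (norm (h(z)))\<^sup>2\<close>.
\<close>

section \<open>Complex inner product spaces\<close>

text \<open>Since \<open>cadjoint\<close> and \<open>sqrt_op\<close> are definite descriptions,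
  nothing can be said about D_A before existence and uniqueness of adjoints and of positive square
  roots are proved. Since D_A's closed range is a set and not a type, \<Gamma> is built on the whole
  ambient space, as the adjoint of an operator \<open>K\<close> with values in that set; V is then
  defined everywhere, and its second component stays in the set automatically. The feedback is the
  adjoint of \<Gamma> because this completes a square: with \<eta> = z T \<xi> and w = p + K \<eta>,
  the terms 2 <p, K \<eta>> + |p|^2 equal |w|^2 - |K \<eta>|^2, and the subtracted square pays for
  the second output K T \<xi>. That E and T form an isometric column accounts for the first output.
  In the converse direction the analyticity of h has to be derived from that of V, and norms can be
  compared only on circles of radius r < 1; the limit r -> 1 is taken in finite partial sums.
  Vector-valued function theory rests on scalar Cauchy theory for \<open>cinner (f z) y\<close>,
  while norm estimates of the coefficients come from vector-valued integrals.\<close>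

instance chilbert_space \<subseteq> banach ..

lemma bounded_bilinear_scaleC:
  "bounded_bilinear (scaleC :: complex \<Rightarrow> 'a::complex_inner \<Rightarrow> 'a)"
  by standard
    (auto simp: scaleC_add_left scaleC_add_right scaleR_eq_scaleC scaleC_scaleC scaleC_complex_def
      norm_scaleC mult.commute intro!: exI[of _ 1])

interpretation scaleC: bounded_bilinear scaleC
  by (rule bounded_bilinear_scaleC)

lemma cinner_add_right: "cinner x (y + z) = cinner x y + cinner x (z :: 'a::complex_inner)"
  by (metis cinner_commute cinner_add_left complex_cnj_add)

lemma bounded_bilinear_cinner:
  "bounded_bilinear (cinner :: 'a::complex_inner \<Rightarrow> 'a \<Rightarrow> complex)"
  by standard
    (auto simp: cinner_add_left cinner_add_right scaleR_eq_scaleC scaleC_complex_def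
      cinner_scaleC_left cinner_scaleC_right intro!: exI[of _ 1] Cauchy_Schwarz_cinner)

interpretation cinner: bounded_bilinear cinner
  by (rule bounded_bilinear_cinner)

lemma Re_cinner: "Re (cinner x y) = inner x (y :: 'a::complex_inner)"
  by (simp add: inner_eq_Re_cinner)

text \<open>Since Re (i c) = - Im c, a complex identity splits into two real ones, at x and at i x.
  This is how the real Riesz theorem below serves the complex spaces.\<close>

lemma Im_cinner: "Im (cinner x y) = - inner (\<i> *\<^sub>C x) (y :: 'a::complex_inner)"
  by (simp add: inner_eq_Re_cinner cinner_scaleC_left)

text \<open>The real part of the inner product already separates points: test with x = y -
  z.\<close>

lemma cinner_eqI:
  assumes "\<And>x. inner x y = inner x (z :: 'a::complex_inner)"
  shows "y = z"
proof -
  have "inner (y - z) (y - z) = 0" using assms[of "y - z"] by (simp add: inner_diff_right)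
  then show ?thesis by simp
qed

lemma bounded_clinearI:
  assumes "\<And>x y. T (x + y) = T x + T y" "\<And>c x. T (c *\<^sub>C x) = c *\<^sub>C T x"
    "\<And>x. norm (T x) \<le> K * norm x"
  shows "bounded_clinear T"
  unfolding bounded_clinear_def
  by (intro conjI allI bounded_linear_intro[of _ K])
     (auto simp: assms scaleR_eq_scaleC mult.commute[of _ K])

lemma bounded_clinear_bounded_linear: "bounded_clinear T \<Longrightarrow> bounded_linear T"
  by (simp add: bounded_clinear_def)

lemma bounded_clinear_linear: "bounded_clinear T \<Longrightarrow> linear T"
  by (simp add: bounded_clinear_def bounded_linear.linear)

lemma bounded_clinear_scaleC: "bounded_clinear T \<Longrightarrow> T (c *\<^sub>C x) = c *\<^sub>C T x"
  by (simp add: bounded_clinear_def)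

lemmas bounded_clinear_add = bounded_clinear_linear[THEN linear_add]
  and bounded_clinear_diff = bounded_clinear_linear[THEN linear_diff]
  and bounded_clinear_zero = bounded_clinear_linear[THEN linear_0]

lemma bounded_clinear_compose:
  "bounded_clinear T \<Longrightarrow> bounded_clinear S \<Longrightarrow> bounded_clinear (\<lambda>x. T (S x))"
  by (auto simp: bounded_clinear_def intro: bounded_linear_compose)

lemma bounded_clinear_diff_op:
  "bounded_clinear T \<Longrightarrow> bounded_clinear S \<Longrightarrow> bounded_clinear (\<lambda>x. T x - S x)"
  by (auto simp: bounded_clinear_def bounded_linear_sub scaleC.diff_right)

lemma bounded_clinear_bound:
  assumes "bounded_clinear T"
  obtains K where "K \<ge> 0" "\<And>x. norm (T x) \<le> K * norm x"
  using bounded_linear.nonneg_bounded[of T] assms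
  by (metis bounded_clinear_def mult.commute)

lemma contraction_iff:
  "contraction T \<longleftrightarrow> bounded_clinear T \<and> (\<forall>x. norm (T x) \<le> norm x)"
proof
  assume T: "contraction T"
  then have "norm (T x) \<le> norm x" for x
    using onorm[of T x] mult_right_mono[of "onorm T" 1 "norm x"]
    by (fastforce simp: contraction_def bounded_clinear_def)
  with T show "bounded_clinear T \<and> (\<forall>x. norm (T x) \<le> norm x)"
    by (simp add: contraction_def)
next
  assume "bounded_clinear T \<and> (\<forall>x. norm (T x) \<le> norm x)"
  then show "contraction T"
    by (auto simp: contraction_def intro!: onorm_bound)
qed

lemma contractionD:
  assumes "contraction T"
  shows "bounded_clinear T" "norm (T x) \<le> norm x"
  using assms by (simp_all add: contraction_iff)

section \<open>Riesz representation and adjoints\<close>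

text \<open>
  With \<open>D = id\<close> this is the Riesz representation theorem; in general it represents functionals
  that are dominated by a seminorm \<open>norm (D u)\<close>, by minimizing \<open>(norm (D u))\<^sup>2 - 2 g u\<close>.
\<close>

lemma riesz_representation_range:
  fixes D :: "'a::real_vector \<Rightarrow> 'b::{real_inner, complete_space}" and g :: "'a \<Rightarrow> real"
  assumes D: "linear D" and g: "linear g" and le: "\<And>u. \<bar>g u\<bar> \<le> K * norm (D u)"
  shows "\<exists>y\<in>closure (range D). \<forall>u. g u = inner (D u) y"
proof -
  define J where "J u = (norm (D u))\<^sup>2 - 2 * g u" for u
  define m where "m = (INF u. J u)"
  have "J u \<ge> - K\<^sup>2" for u
    using le[of u] zero_le_power2[of "norm (D u) - K"]
    by (simp add: J_def power2_diff algebra_simps abs_le_iff)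
  then have bdd: "bdd_below (range J)" by (rule bdd_belowI2)
  have m: "m \<le> J u" for u
    unfolding m_def by (rule cINF_lower[OF bdd]) simp
  have "\<exists>u. J u < m + 1 / Suc n" for n
    using cINF_less_iff[of UNIV J "m + 1 / Suc n"] bdd by (auto simp: m_def)
  then obtain u where u: "\<And>n. J (u n) < m + 1 / Suc n" by metis
  have J_lim: "(\<lambda>n. J (u n)) \<longlonglongrightarrow> m"
  proof (rule tendsto_sandwich[of "\<lambda>_. m" _ _ "\<lambda>n. m + 1 / Suc n"])
    show "(\<lambda>n. m + 1 / Suc n) \<longlonglongrightarrow> m" by real_asymp
  qed (use m u in \<open>auto intro: less_imp_le always_eventually\<close>)
  \<comment> \<open>The parallelogram law, with the midpoint of a and b inserted into
    \<open>J \<ge> m\<close>. It makes the images \<open>D (u n)\<close> of a minimizing sequence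
    Cauchy; the \<open>u n\<close> themselves may diverge.\<close>
  have para: "(norm (D a - D b))\<^sup>2 \<le> 2 * J a + 2 * J b - 4 * m" for a b
  proof -
    have 1: "(norm (D ((1/2) *\<^sub>R (a + b))))\<^sup>2 = (1/4) * (norm (D a + D b))\<^sup>2"
      by (simp add: linear_scale[OF D] linear_add[OF D] power_divide)
    have 2: "g ((1/2) *\<^sub>R (a + b)) = (g a + g b) / 2"
      by (simp add: linear_scale[OF g] linear_add[OF g])
    have 3: "(norm (D a + D b))\<^sup>2 + (norm (D a - D b))\<^sup>2 = 2 * (norm (D a))\<^sup>2 + 2 * (norm (D b))\<^sup>2"
      by (simp add: power2_norm_eq_inner inner_add_left inner_add_right inner_diff_left
          inner_diff_right inner_commute)
    show ?thesis
      using m[of "(1/2) *\<^sub>R (a + b)"] 3 unfolding J_def 1 2 by argo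
  qed
  have "Cauchy (\<lambda>n. D (u n))"
  proof (rule CauchyI)
    fix e :: real assume e: "0 < e"
    then obtain N where N: "\<And>n. n \<ge> N \<Longrightarrow> J (u n) < m + e\<^sup>2 / 4"
      using order_tendstoD(2)[OF J_lim, of "m + e\<^sup>2 / 4"] by (auto simp: eventually_sequentially)
    have "norm (D (u i) - D (u j)) < e" if "i \<ge> N" "j \<ge> N" for i j
    proof -
      have "(norm (D (u i) - D (u j)))\<^sup>2 < e\<^sup>2"
        using para[of "u i" "u j"] N[OF that(1)] N[OF that(2)] by linarith
      then show ?thesis using e by (simp add: power2_less_imp_less)
    qed
    then show "\<exists>M. \<forall>m\<ge>M. \<forall>n\<ge>M. norm (D (u m) - D (u n)) < e" by blast
  qed
  then obtain y where y: "(\<lambda>n. D (u n)) \<longlonglongrightarrow> y"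
    using Cauchy_convergent convergent_def by blast
  have "g v = inner (D v) y" for v
  proof -
    define c where "c = inner y (D v) - g v"
    \<comment> \<open>First variation at the infimum. The limit y need not lie in the range of D, so
      the variation is computed along the minimizing sequence and then passed to the limit.\<close>
    have "0 \<le> 2 * t * c + t\<^sup>2 * (norm (D v))\<^sup>2" for t
    proof (rule tendsto_le[OF trivial_limit_sequentially])
      show "(\<lambda>n. J (u n + t *\<^sub>R v) - J (u n)) \<longlonglongrightarrow> 2 * t * c + t\<^sup>2 * (norm (D v))\<^sup>2"
      proof -
        have "J (u n + t *\<^sub>R v) - J (u n)
            = 2 * t * (inner (D (u n)) (D v) - g v) + t\<^sup>2 * (norm (D v))\<^sup>2" for n
          using dot_norm[of "D (u n)" "t *\<^sub>R D v"]
          by (simp add: J_def linear_add[OF D] linear_add[OF g] linear_scale[OF D]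
              linear_scale[OF g] field_simps power2_eq_square)
        then show ?thesis unfolding c_def by (auto intro!: tendsto_intros y)
      qed
      show "(\<lambda>n. m - J (u n)) \<longlonglongrightarrow> 0" using tendsto_diff[OF tendsto_const[of m] J_lim] by simp
      show "\<forall>\<^sub>F n in sequentially. m - J (u n) \<le> J (u n + t *\<^sub>R v) - J (u n)"
        using m by simp
    qed
    note quad = this
    have "c = 0"
    proof (rule ccontr)
      assume c: "c \<noteq> 0"
      \<comment> \<open>The added 1 keeps the test value t = - c / N meaningful when D v =
        0.\<close>
      define N where "N = (norm (D v))\<^sup>2 + 1"
      have N: "N > 0" by (simp add: N_def add_nonneg_pos)
      have "0 \<le> 2 * (- c / N) * c + (- c / N)\<^sup>2 * (N - 1)"
        using quad[of "- c / N"] by (simp add: N_def)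
      also have "\<dots> = - c\<^sup>2 * (N + 1) / N\<^sup>2"
        using N by (simp add: field_simps power2_eq_square)
      also have "\<dots> < 0" using c N by (intro divide_neg_pos mult_neg_pos) auto
      finally show False by simp
    qed
    then show ?thesis by (simp add: c_def inner_commute)
  qed
  moreover have "y \<in> closure (range D)"
    unfolding closure_sequential using y by (intro exI[of _ "\<lambda>n. D (u n)"]) simp
  ultimately show ?thesis by blast
qed

lemma cinner_eq_of_inner:
  fixes T :: "'a::complex_inner \<Rightarrow> 'b::complex_inner"
  assumes "\<And>c x. T (c *\<^sub>C x) = c *\<^sub>C T x" "\<And>x. inner (T x) y = inner x z"
  shows "cinner (T x) y = cinner x z"
  using assms(2)[of "\<i> *\<^sub>C x"]
  by (intro complex_eqI) (simp_all add: Re_cinner Im_cinner assms)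

text \<open>The adjoint relation alone forces linearity, by testing against all x; the bound comes
  from |S y|^2 = <T (S y), y>.\<close>

lemma bounded_clinear_adjointI:
  fixes S :: "'b::complex_inner \<Rightarrow> 'a::complex_inner"
  assumes "\<And>x y. cinner (T x) y = cinner x (S y)" and "\<And>x. norm (T x) \<le> K * norm x"
    and K: "K \<ge> 0"
  shows "bounded_clinear S" "norm (S y) \<le> K * norm y"
proof -
  have "inner x (S (a + b)) = inner x (S a + S b)" for x a b
    by (simp add: inner_eq_Re_cinner assms(1)[symmetric] cinner_add_right)
  then have add: "S (a + b) = S a + S b" for a b by (rule cinner_eqI)
  have "inner x (S (c *\<^sub>C a)) = inner x (c *\<^sub>C S a)" for x c a
    by (simp add: inner_eq_Re_cinner assms(1)[symmetric] cinner_scaleC_right)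
  then have scale: "S (c *\<^sub>C a) = c *\<^sub>C S a" for c a by (rule cinner_eqI)
  have bound: "norm (S y) \<le> K * norm y" for y
  proof (cases "S y = 0")
    case True
    with K show ?thesis by simp
  next
    case False
    have "(norm (S y))\<^sup>2 = inner (T (S y)) y"
      unfolding power2_norm_eq_inner inner_eq_Re_cinner assms(1) ..
    also have "\<dots> \<le> norm (T (S y)) * norm y" by (rule norm_cauchy_schwarz)
    also have "\<dots> \<le> (K * norm (S y)) * norm y"
      by (intro mult_right_mono assms) auto
    finally show ?thesis using False by (simp add: power2_eq_square mult.assoc mult.left_commute)
  qed
  show "norm (S y) \<le> K * norm y" by (rule bound)
  show "bounded_clinear S" by (rule bounded_clinearI[OF add scale bound])
qed

text \<open>Riesz supplies the existence that the definite description in \<open>cadjoint\<close>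
  requires, and testing against all vectors supplies uniqueness.\<close>

lemma cinner_cadjoint:
  fixes T :: "'a::chilbert_space \<Rightarrow> 'b::complex_inner"
  assumes T: "bounded_clinear T"
  shows "cinner (T x) y = cinner x (cadjoint T y)"
proof -
  obtain K where K: "\<And>x. norm (T x) \<le> K * norm x" using bounded_clinear_bound[OF T] by blast
  have "\<exists>z. \<forall>x. inner (T x) y = inner x z" for y
  proof -
    have "\<bar>inner (T x) y\<bar> \<le> K * norm y * norm x" for x
      using Cauchy_Schwarz_ineq2[of "T x" y] mult_right_mono[OF K[of x], of "norm y"]
      by (simp add: mult_ac)
    moreover have "linear (\<lambda>x. inner (T x) y)"
      using bounded_clinear_linear[OF T] by (auto simp: linear_iff inner_add_left)
    ultimately show ?thesis
      using riesz_representation_range[of "\<lambda>x. x" "\<lambda>x. inner (T x) y" "K * norm y"]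
      by (auto simp: linear_iff)
  qed
  then obtain S where S: "\<And>x y. inner (T x) y = inner x (S y)" by metis
  have "(\<forall>x y. cinner (T x) y = cinner x (cadjoint T y))"
    unfolding cadjoint_def
  proof (rule theI[of "\<lambda>S. \<forall>x y. cinner (T x) y = cinner x (S y)"])
    show "\<forall>x y. cinner (T x) y = cinner x (S y)"
      by (intro allI cinner_eq_of_inner bounded_clinear_scaleC T S)
    fix S' assume "\<forall>x y. cinner (T x) y = cinner x (S' y)"
    then show "S' = S" by (intro ext cinner_eqI) (metis S inner_eq_Re_cinner)
  qed
  then show ?thesis by blast
qed

lemma inner_cadjoint:
  fixes T :: "'a::chilbert_space \<Rightarrow> 'b::complex_inner"
  shows "bounded_clinear T \<Longrightarrow> inner (T x) y = inner x (cadjoint T y)"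
  by (simp add: inner_eq_Re_cinner cinner_cadjoint)

lemma
  fixes T :: "'a::chilbert_space \<Rightarrow> 'b::complex_inner"
  assumes T: "bounded_clinear T"
  shows bounded_clinear_cadjoint: "bounded_clinear (cadjoint T)"
    and norm_cadjoint_le: "(\<And>x. norm (T x) \<le> norm x) \<Longrightarrow> norm (cadjoint T y) \<le> norm y"
proof -
  obtain K where "K \<ge> 0" "\<And>x. norm (T x) \<le> K * norm x" using bounded_clinear_bound[OF T] by blast
  then show "bounded_clinear (cadjoint T)"
    using bounded_clinear_adjointI(1)[of T "cadjoint T" K] cinner_cadjoint[OF T] by blast
  show "norm (cadjoint T y) \<le> norm y" if "\<And>x. norm (T x) \<le> norm x"
    using bounded_clinear_adjointI(2)[of T "cadjoint T" 1] cinner_cadjoint[OF T] that by simp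
qed

section \<open>Square roots of positive operators\<close>

text \<open>Polarization: the quadratic form is real at x + y and at x + i y, which fixes the
  imaginary and the real part of the form at the pair x, y.\<close>

lemma positive_op_selfadjoint:
  assumes P: "positive_op P"
  shows "cinner (P x) y = cinner x (P y)"
proof -
  have lin: "bounded_clinear P" and im: "\<And>z. Im (cinner (P z) z) = 0"
    using P by (auto simp: positive_op_def complex_is_Real_iff)
  have "Im (cinner (P x) y) + Im (cinner (P y) x) = 0"
    using im[of "x + y"] im[of x] im[of y]
    by (simp add: bounded_clinear_add[OF lin] cinner_add_left cinner_add_right)
  moreover have "Re (cinner (P y) x) = Re (cinner (P x) y)"
    using im[of "x + \<i> *\<^sub>C y"] im[of x] im[of y]
    by (simp add: bounded_clinear_add[OF lin] bounded_clinear_scaleC[OF lin] cinner_add_left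
        cinner_add_right cinner_scaleC_left cinner_scaleC_right)
  ultimately have "cinner (P x) y = cnj (cinner (P y) x)" by (intro complex_eqI) auto
  then show ?thesis by (metis cinner_commute)
qed

text \<open>Moving from y in the direction - P y changes the form by - 2 t |P y|^2 to first order,
  so it would become negative for small t unless P y = 0.\<close>

lemma positive_op_eq_0:
  assumes P: "positive_op P" and 0: "inner (P y) y = 0"
  shows "P y = 0"
proof (rule ccontr)
  assume "P y \<noteq> 0"
  then have pos: "(norm (P y))\<^sup>2 > 0" by simp
  have lin: "bounded_clinear P" using P by (simp add: positive_op_def)
  obtain K where K: "K \<ge> 0" "\<And>x. norm (P x) \<le> K * norm x" using bounded_clinear_bound[OF lin] by blast
  \<comment> \<open>Small enough for the quadratic term, at most t^2 K |P y|^2, to lose against 2 t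
    |P y|^2; the added 1 covers K = 0.\<close>
  define t where "t = 1 / (K + 1)"
  have t: "t > 0" "t * K < 1" using K(1) by (auto simp: t_def)
  have "0 \<le> inner (P (y - t *\<^sub>R P y)) (y - t *\<^sub>R P y)"
    using P by (simp add: positive_op_def inner_eq_Re_cinner)
  also have "\<dots> = t\<^sup>2 * inner (P (P y)) (P y) - t * (norm (P y))\<^sup>2 - t * inner (P (P y)) y"
    using 0 by (simp add: bounded_clinear_diff[OF lin] linear_scale[OF bounded_clinear_linear[OF lin]]
        inner_diff_left inner_diff_right dot_square_norm algebra_simps power2_eq_square[of t])
  also have "inner (P (P y)) y = (norm (P y))\<^sup>2"
    by (simp add: power2_norm_eq_inner inner_eq_Re_cinner positive_op_selfadjoint[OF P])
  also have "inner (P (P y)) (P y) \<le> K * (norm (P y))\<^sup>2"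
    using norm_cauchy_schwarz[of "P (P y)" "P y"] mult_right_mono[OF K(2)[of "P y"], of "norm (P y)"]
    by (simp add: power2_eq_square mult_ac)
  finally have "0 \<le> t\<^sup>2 * (K * (norm (P y))\<^sup>2) - t * (norm (P y))\<^sup>2 - t * (norm (P y))\<^sup>2"
    by (simp add: mult_left_mono)
  then have "0 \<le> t * (t * K - 2) * (norm (P y))\<^sup>2"
    by (simp add: algebra_simps power2_eq_square)
  moreover have "t * (t * K - 2) < 0" using t by (intro mult_pos_neg) auto
  then have "t * (t * K - 2) * (norm (P y))\<^sup>2 < 0" using pos by (rule mult_neg_pos)
  ultimately show False by linarith
qed

text \<open>
  The iteration \<open>X \<mapsto> (B + X\<^sup>2) / 2\<close> converges to the solution \<open>X\<close> of \<open>(I - X)\<^sup>2 = I - B\<close>; its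
  increments are dominated by those of the scalar iteration \<open>q \<mapsto> (1 + q\<^sup>2) / 2\<close>.
\<close>

primrec sqrt_iter :: "('a::real_vector \<Rightarrow> 'a) \<Rightarrow> nat \<Rightarrow> 'a \<Rightarrow> 'a" where
  "sqrt_iter B 0 x = 0"
| "sqrt_iter B (Suc n) x = (1/2) *\<^sub>R (B x + sqrt_iter B n (sqrt_iter B n x))"

primrec sqrt_bound :: "nat \<Rightarrow> real" where
  "sqrt_bound 0 = 0"
| "sqrt_bound (Suc n) = (1 + (sqrt_bound n)\<^sup>2) / 2"

lemma sqrt_bound: "0 \<le> sqrt_bound n" "sqrt_bound n \<le> 1" "sqrt_bound n \<le> sqrt_bound (Suc n)"
proof -
  show *: "0 \<le> sqrt_bound n" for n by (induction n) auto
  show "sqrt_bound n \<le> 1" by (induction n) (auto simp: * power_le_one)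
  show "sqrt_bound n \<le> sqrt_bound (Suc n)"
    using zero_le_power2[of "sqrt_bound n - 1"] by (simp add: power2_diff)
qed

text \<open>The instance in view is B = (adjoint of A) A, for which the square root of I - B is the
  defect operator.\<close>

locale selfadjoint_contraction =
  fixes B :: "'a::chilbert_space \<Rightarrow> 'a"
  assumes lin: "bounded_clinear B" and bound: "norm (B x) \<le> norm x"
    and selfadjoint: "cinner (B x) y = cinner x (B y)"
begin

abbreviation "X \<equiv> sqrt_iter B"
abbreviation "q \<equiv> sqrt_bound"

lemma X_clinear: "X n (x + y) = X n x + X n y" "X n (c *\<^sub>C x) = c *\<^sub>C X n x"
proof (induction n arbitrary: x y)
  case (Suc n)
  { case 1 show ?case
      by (simp only: sqrt_iter.simps bounded_clinear_add[OF lin] Suc scaleR_add_right[symmetric] add_ac) }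
  { case 2 show ?case
      by (simp add: bounded_clinear_scaleC[OF lin] Suc scaleC_add_right scaleR_eq_scaleC
          scaleC_scaleC mult.commute) }
qed (auto simp: scaleC.zero_right)

lemma linear_X: "linear (X n)"
  by (auto simp: linear_iff X_clinear scaleR_eq_scaleC)

text \<open>The iterates are polynomials in B. The commutation is used twice: to factor a difference
  of squares of iterates, and, in the limit, to show that every other positive root commutes with
  the constructed one.\<close>

lemma X_commute:
  assumes Y: "linear Y" "\<And>x. Y (B x) = B (Y x)"
  shows "Y (X n x) = X n (Y x)"
  by (induction n arbitrary: x) (auto simp: linear_0 linear_scale linear_add Y)

lemma X_commute_X: "X m (X n x) = X n (X m x)"
  by (intro X_commute linear_X) (metis X_commute lin bounded_clinear_linear)

lemma norm_X: "norm (X n x) \<le> q n * norm x"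
proof (induction n arbitrary: x)
  case (Suc n)
  have "norm (B x + X n (X n x)) \<le> norm x + (q n)\<^sup>2 * norm x"
    using norm_triangle_ineq[of "B x" "X n (X n x)"] bound[of x] Suc[of "X n x"]
      mult_left_mono[OF Suc[of x] sqrt_bound(1)[of n]]
    by (simp add: power2_eq_square mult.assoc)
  then show ?case by (simp add: algebra_simps del: scaleR_add_right)
qed simp

text \<open>Consecutive increments satisfy 2 (X'' - X') = X'^2 - X^2 = (X' + X) (X' - X), because
  iterates commute. The scalars \<open>q\<close> obey the same recursion with equality.\<close>

lemma norm_X_diff: "norm (X (Suc n) x - X n x) \<le> (q (Suc n) - q n) * norm x"
proof (induction n)
  case 0
  show ?case using bound[of x] by (simp add: linear_0[OF linear_X])
next
  case (Suc n)
  define d where "d = X (Suc n) x - X n x"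
  have "X (Suc (Suc n)) x - X (Suc n) x
      = (1/2) *\<^sub>R (X (Suc n) (X (Suc n) x) - X n (X n x))"
    unfolding sqrt_iter.simps(2)[of B "Suc n"] sqrt_iter.simps(2)[of B n x]
    by (simp only: scaleR_diff_right[symmetric]) simp
  also have "X (Suc n) (X (Suc n) x) - X n (X n x) = X (Suc n) d + X n d"
    unfolding d_def linear_diff[OF linear_X] X_commute_X[of "Suc n" n] by (simp del: sqrt_iter.simps)
  finally have eq: "X (Suc (Suc n)) x - X (Suc n) x = (1/2) *\<^sub>R (X (Suc n) d + X n d)" .
  have "norm (X (Suc n) d + X n d) \<le> (q (Suc n) + q n) * norm d"
    using norm_triangle_ineq[of "X (Suc n) d" "X n d"] norm_X[of "Suc n" d] norm_X[of n d]
    by (simp only: distrib_right)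
  also have "\<dots> \<le> (q (Suc n) + q n) * ((q (Suc n) - q n) * norm x)"
    using Suc sqrt_bound(1)[of n] sqrt_bound(1)[of "Suc n"] unfolding d_def
    by (intro mult_left_mono) auto
  also have "\<dots> = 2 * ((q (Suc (Suc n)) - q (Suc n)) * norm x)"
    unfolding sqrt_bound.simps(2)[of "Suc n"] sqrt_bound.simps(2)[of n, symmetric]
    using sqrt_bound.simps(2)[of n] by (simp add: field_simps power2_eq_square)
  finally show ?case unfolding eq by simp
qed

text \<open>The majorants telescope to \<open>q n * norm x\<close>, and \<open>q\<close> stays below
  its fixed point 1, so the increments are absolutely summable at each vector.\<close>

lemma X_convergent: "convergent (\<lambda>n. X n x)"
proof -
  have "summable (\<lambda>n. (q (Suc n) - q n) * norm x)"
  proof (rule summableI_nonneg_bounded)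
    show "(\<Sum>k<n. (q (Suc k) - q k) * norm x) \<le> norm x" for n
      unfolding sum_distrib_right[symmetric] sum_lessThan_telescope
      using sqrt_bound(2)[of n] by (simp add: mult_left_le_one_le sqrt_bound(1))
  qed (use sqrt_bound(3) in \<open>simp del: sqrt_bound.simps\<close>)
  then have "summable (\<lambda>n. X (Suc n) x - X n x)"
    by (rule summable_comparison_test[rotated]) (use norm_X_diff in blast)
  then have "convergent (\<lambda>n. \<Sum>k<n. X (Suc k) x - X k x)"
    by (simp only: summable_iff_convergent)
  then show ?thesis
    unfolding sum_lessThan_telescope[of "\<lambda>k. X k x"] by simp
qed

definition "Y x = lim (\<lambda>n. X n x)"

lemma X_lim: "(\<lambda>n. X n x) \<longlonglongrightarrow> Y x"
  using X_convergent unfolding Y_def convergent_LIMSEQ_iff .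

lemma norm_Y: "norm (Y x) \<le> norm x"
proof (rule LIMSEQ_le_const2[OF tendsto_norm[OF X_lim]])
  show "\<exists>N. \<forall>n\<ge>N. norm (X n x) \<le> norm x"
    using norm_X[of _ x] sqrt_bound by (meson mult_left_le_one_le norm_ge_zero order_trans)
qed

lemma Y_bounded_clinear: "bounded_clinear Y"
proof (rule bounded_clinearI[of _ 1])
  show "Y (x + y) = Y x + Y y" for x y
    using X_lim[of "x + y"] tendsto_add[OF X_lim[of x] X_lim[of y]]
    unfolding X_clinear by (rule LIMSEQ_unique)
  show "Y (c *\<^sub>C x) = c *\<^sub>C Y x" for c x
    using X_lim[of "c *\<^sub>C x"] scaleC.tendsto[OF tendsto_const X_lim[of x]]
    unfolding X_clinear by (rule LIMSEQ_unique)
qed (simp add: norm_Y)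

lemma Y_selfadjoint: "cinner (Y x) y = cinner x (Y y)"
proof (rule LIMSEQ_unique)
  have *: "cinner (X n x) y = cinner x (X n y)" for n x y
    by (induction n arbitrary: x y)
      (auto simp: scaleR_eq_scaleC cinner_scaleC_left cinner_scaleC_right cinner_add_left
        cinner_add_right selfadjoint cinner.zero_left cinner.zero_right)
  show "(\<lambda>n. cinner (X n x) y) \<longlonglongrightarrow> cinner x (Y y)"
    unfolding * by (intro cinner.tendsto X_lim tendsto_const)
  show "(\<lambda>n. cinner (X n x) y) \<longlonglongrightarrow> cinner (Y x) y"
    by (intro cinner.tendsto X_lim tendsto_const)
qed

lemma Y_fixpoint: "2 *\<^sub>R Y x = B x + Y (Y x)"
proof (rule LIMSEQ_unique)
  \<comment> \<open>Convergence is only pointwise, so the square is split: the uniform bound on the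
    norms of the iterates disposes of the first summand, and pointwise convergence at
    \<open>Y x\<close> of the second.\<close>
  have "(\<lambda>n. X n (X n x - Y x) + X n (Y x)) \<longlonglongrightarrow> 0 + Y (Y x)"
  proof (intro tendsto_add X_lim)
    have *: "norm (X n (X n x - Y x)) \<le> norm (X n x - Y x)" for n
      using norm_X[of n "X n x - Y x"] sqrt_bound[of n]
      by (meson mult_left_le_one_le norm_ge_zero order_trans)
    show "(\<lambda>n. X n (X n x - Y x)) \<longlonglongrightarrow> 0"
      using tendsto_norm_zero[OF LIM_zero[OF X_lim[of x]]]
      by (rule Lim_null_comparison[rotated]) (intro always_eventually allI *)
  qed
  then have "(\<lambda>n. X n (X n x)) \<longlonglongrightarrow> Y (Y x)" 
    by (simp only: linear_diff[OF linear_X] diff_add_cancel add_0_left)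
  then have "(\<lambda>n. B x + X n (X n x)) \<longlonglongrightarrow> B x + Y (Y x)" by (intro tendsto_intros)
  then show "(\<lambda>n. 2 *\<^sub>R X (Suc n) x) \<longlonglongrightarrow> B x + Y (Y x)" by simp
  show "(\<lambda>n. 2 *\<^sub>R X (Suc n) x) \<longlonglongrightarrow> 2 *\<^sub>R Y x"
    by (intro tendsto_intros LIMSEQ_Suc X_lim)
qed

lemma Y_commute:
  assumes Z: "bounded_clinear Z" "\<And>x. Z (B x) = B (Z x)"
  shows "Z (Y x) = Y (Z x)"
proof (rule LIMSEQ_unique)
  show "(\<lambda>n. X n (Z x)) \<longlonglongrightarrow> Y (Z x)" by (rule X_lim)
  have "(\<lambda>n. Z (X n x)) \<longlonglongrightarrow> Z (Y x)"
    by (rule bounded_linear.tendsto[OF bounded_clinear_bounded_linear[OF Z(1)] X_lim])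
  then show "(\<lambda>n. X n (Z x)) \<longlonglongrightarrow> Z (Y x)"
    unfolding X_commute[OF bounded_clinear_linear[OF Z(1)] Z(2)] .
qed

definition "S x = x - Y x"

lemma S_square: "S (S x) = x - B x"
proof -
  have "B x = Y x + Y x - Y (Y x)"
    using Y_fixpoint[of x] by (simp add: scaleR_2 eq_diff_eq)
  then show ?thesis
    by (simp add: S_def bounded_clinear_diff[OF Y_bounded_clinear])
qed

lemma positive_op_S: "positive_op S"
  unfolding positive_op_def
proof (intro conjI allI)
  have "bounded_clinear (\<lambda>x::'a. x)" by (rule bounded_clinearI[of _ 1]) auto
  from bounded_clinear_diff_op[OF this Y_bounded_clinear] show "bounded_clinear S"
    by (simp add: S_def[abs_def])
  fix x
  have "cinner (S x) x = cinner x (S x)"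
    by (simp add: S_def cinner.diff_left cinner.diff_right Y_selfadjoint)
  then show "cinner (S x) x \<in> \<real>"
    by (metis cinner_commute Reals_cnj_iff)
  have "inner (Y x) x \<le> norm x * norm x"
    using norm_cauchy_schwarz[of "Y x" x] mult_right_mono[OF norm_Y[of x], of "norm x"] by simp
  then show "0 \<le> Re (cinner (S x) x)"
    by (simp add: Re_cinner S_def inner_diff_left dot_square_norm power2_eq_square)
qed

text \<open>For y = S x - P x, commutation gives (S + P) y = S^2 x - P^2 x = 0. Both forms are
  nonnegative, hence both vanish at y, so S y = P y = 0, and |y|^2 = <x, (S - P) y> = 0.\<close>

lemma positive_sqrt_unique:
  assumes P: "positive_op P" "P \<circ> P = (\<lambda>x. x - B x)"
  shows "P = S"
proof
  fix x
  have lin: "bounded_clinear P" using P by (simp add: positive_op_def)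
  note lin_S = positive_op_S[unfolded positive_op_def, THEN conjunct1]
  have PP: "P (P x) = x - B x" for x using P(2) by (metis comp_apply)
  \<comment> \<open>P commutes with its own square I - B, hence with B and with the limit Y of
    polynomials in B.\<close>
  have "P (B x) = B (P x)" for x
    using PP[of "P x"] PP[of x] by (metis bounded_clinear_diff[OF lin] diff_diff_eq2 add_diff_cancel_left')
  from Y_commute[OF lin this] have SP: "P (S x) = S (P x)" for x
    by (simp add: S_def bounded_clinear_diff[OF lin])
  define y where "y = S x - P x"
  have "S y + P y = 0"
    by (simp add: y_def bounded_clinear_diff[OF lin] bounded_clinear_diff[OF lin_S] SP S_square PP)
  then have "inner (S y) y + inner (P y) y = 0"
    by (metis inner_add_left inner_zero_left)
  moreover have "inner (S y) y \<ge> 0" "inner (P y) y \<ge> 0"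
    using P positive_op_S by (auto simp: positive_op_def inner_eq_Re_cinner)
  ultimately have "inner (S y) y = 0" "inner (P y) y = 0" by linarith+
  then have "S y = 0" "P y = 0"
    using positive_op_eq_0[OF positive_op_S] positive_op_eq_0[OF P(1)] by blast+
  then have "inner y y = 0"
    by (simp add: y_def inner_eq_Re_cinner cinner.diff_left positive_op_selfadjoint[OF P(1)]
        positive_op_selfadjoint[OF positive_op_S])
  then show "P x = S x" by (simp add: y_def)
qed

lemma sqrt_op: "positive_op (sqrt_op (\<lambda>x. x - B x))"
  "sqrt_op (\<lambda>x. x - B x) (sqrt_op (\<lambda>x. x - B x) x) = x - B x"
proof -
  have "sqrt_op (\<lambda>x. x - B x) = S"
    unfolding sqrt_op_def
    by (rule the_equality) (auto simp: positive_op_S S_square positive_sqrt_unique)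
  then show "positive_op (sqrt_op (\<lambda>x. x - B x))"
    "sqrt_op (\<lambda>x. x - B x) (sqrt_op (\<lambda>x. x - B x) x) = x - B x"
    by (simp_all add: positive_op_S S_square)
qed

end

section \<open>Defect operators\<close>

lemma
  fixes A :: "'a::chilbert_space \<Rightarrow> 'b::complex_inner"
  assumes A: "contraction A"
  shows positive_op_defect_op: "positive_op (defect_op A)"
    and defect_op_square: "defect_op A (defect_op A x) = x - cadjoint A (A x)"
proof -
  note lin = contractionD(1)[OF A] and le = contractionD(2)[OF A]
  interpret selfadjoint_contraction "\<lambda>x. cadjoint A (A x)"
  proof
    show "bounded_clinear (\<lambda>x. cadjoint A (A x))"
      by (rule bounded_clinear_compose[OF bounded_clinear_cadjoint[OF lin] lin])
    show "norm (cadjoint A (A x)) \<le> norm x" for x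
      using norm_cadjoint_le[OF lin le] le order_trans by blast
    show "cinner (cadjoint A (A x)) y = cinner x (cadjoint A (A y))" for x y
      unfolding cinner_cadjoint[OF lin, symmetric]
      by (subst (1 2) cinner_commute) (simp add: cinner_cadjoint[OF lin])
  qed
  show "positive_op (defect_op A)" "defect_op A (defect_op A x) = x - cadjoint A (A x)"
    unfolding defect_op_def by (rule sqrt_op)+
qed

lemma bounded_clinear_defect_op:
  "contraction A \<Longrightarrow> bounded_clinear (defect_op (A :: 'a::chilbert_space \<Rightarrow> 'b::complex_inner))"
  using positive_op_defect_op positive_op_def by blast

text \<open>This identity converts the norm condition on the bilateral sequence into a bound by
  \<open>defect_op A\<close>.\<close>

lemma norm_defect_op:
  fixes A :: "'a::chilbert_space \<Rightarrow> 'b::complex_inner"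
  assumes A: "contraction A"
  shows "(norm (defect_op A x))\<^sup>2 = (norm x)\<^sup>2 - (norm (A x))\<^sup>2"
proof -
  have "(norm (defect_op A x))\<^sup>2 = inner x (defect_op A (defect_op A x))"
    unfolding power2_norm_eq_inner inner_eq_Re_cinner positive_op_selfadjoint[OF positive_op_defect_op[OF A]] ..
  also have "\<dots> = (norm x)\<^sup>2 - (norm (A x))\<^sup>2"
    using A by (simp add: defect_op_square inner_diff_right contraction_iff inner_cadjoint[symmetric]
        power2_norm_eq_inner)
  finally show ?thesis .
qed

lemma
  assumes T: "bounded_clinear T"
  shows closure_range_add:
      "\<lbrakk>y \<in> closure (range T); z \<in> closure (range T)\<rbrakk> \<Longrightarrow> y + z \<in> closure (range T)"
    and closure_range_scaleC: "y \<in> closure (range T) \<Longrightarrow> c *\<^sub>C y \<in> closure (range T)"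
proof -
  assume y: "y \<in> closure (range T)"
  obtain f where f: "\<forall>n. f n \<in> range T" "f \<longlonglongrightarrow> y"
    using y unfolding closure_sequential by (elim exE conjE)
  have "c *\<^sub>C f n \<in> range T" for n
  proof -
    obtain a where "f n = T a" using f(1) by (meson rangeE)
    then show ?thesis by (simp add: bounded_clinear_scaleC[OF T, symmetric])
  qed
  then show "c *\<^sub>C y \<in> closure (range T)"
    unfolding closure_sequential
    by (intro exI[of _ "\<lambda>n. c *\<^sub>C f n"] conjI allI scaleC.tendsto tendsto_const f)
  assume z: "z \<in> closure (range T)"
  obtain g where g: "\<forall>n. g n \<in> range T" "g \<longlonglongrightarrow> z"
    using z unfolding closure_sequential by (elim exE conjE)
  have "f n + g n \<in> range T" for n
  proof -
    obtain a b where "f n = T a" "g n = T b" using f(1) g(1) by (meson rangeE)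
    then show ?thesis by (simp add: bounded_clinear_add[OF T, symmetric])
  qed
  then show "y + z \<in> closure (range T)"
    unfolding closure_sequential
    by (intro exI[of _ "\<lambda>n. f n + g n"] conjI allI tendsto_add f g)
qed

lemma
  fixes A :: "'a::chilbert_space \<Rightarrow> 'b::complex_inner"
  shows closed_defect_space: "closed (defect_space A)"
    and defect_op_in_defect_space: "defect_op A x \<in> defect_space A"
  using closure_subset[of "range (defect_op A)"] by (auto simp: defect_space_def)

lemma defect_space_subspace:
  fixes A :: "'a::chilbert_space \<Rightarrow> 'b::complex_inner"
  assumes A: "contraction A"
  shows "0 \<in> defect_space A"
    "\<lbrakk>y \<in> defect_space A; z \<in> defect_space A\<rbrakk> \<Longrightarrow> y + z \<in> defect_space A"
    "y \<in> defect_space A \<Longrightarrow> c *\<^sub>C y \<in> defect_space A"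
proof -
  note lin = bounded_clinear_defect_op[OF A]
  show "0 \<in> defect_space A"
    using defect_op_in_defect_space[of A 0] by (simp add: bounded_clinear_zero[OF lin])
  show "\<lbrakk>y \<in> defect_space A; z \<in> defect_space A\<rbrakk> \<Longrightarrow> y + z \<in> defect_space A"
    unfolding defect_space_def by (rule closure_range_add[OF lin])
  show "y \<in> defect_space A \<Longrightarrow> c *\<^sub>C y \<in> defect_space A"
    unfolding defect_space_def by (rule closure_range_scaleC[OF lin])
qed

text \<open>Banach's fixed point theorem solves y = x + (adjoint of A) A y, so the square of the
  defect operator is onto. Its range is then the whole space even before taking the closure.\<close>

lemma defect_space_strict_contraction:
  fixes A :: "'a::chilbert_space \<Rightarrow> 'b::complex_inner"
  assumes A: "contraction A" and less: "onorm A < 1"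
  shows "defect_space A = UNIV"
proof -
  note lin = contractionD(1)[OF A] and le = contractionD(2)[OF A]
  note bl = bounded_clinear_bounded_linear[OF lin]
  have "x \<in> defect_space A" for x
  proof -
    have "\<exists>!y\<in>UNIV. x + cadjoint A (A y) = y"
    proof (rule Banach_fix)
      show "dist (x + cadjoint A (A a)) (x + cadjoint A (A b)) \<le> onorm A * dist a b" for a b
      proof -
        have "norm (cadjoint A (A (a - b))) \<le> norm (A (a - b))"
          by (rule norm_cadjoint_le[OF lin le])
        also have "\<dots> \<le> onorm A * norm (a - b)" by (rule onorm[OF bl])
        finally show ?thesis
          by (simp add: dist_norm bounded_clinear_diff[OF lin]
              bounded_clinear_diff[OF bounded_clinear_cadjoint[OF lin]])
      qed
    qed (auto simp: less onorm_pos_le[OF bl] complete_UNIV)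
    then obtain y where "x + cadjoint A (A y) = y" by blast
    then have "x = defect_op A (defect_op A y)" by (simp add: defect_op_square[OF A] algebra_simps)
    then show ?thesis using defect_op_in_defect_space[of A] by simp
  qed
  then show ?thesis by blast
qed

text \<open>The vector a - b is orthogonal to the range, hence to its closure, which contains both a
  and b. This makes the Riesz vector in the closed range unique.\<close>

lemma closure_range_eqI:
  assumes "bounded_clinear (D :: 'a::complex_inner \<Rightarrow> 'b::complex_inner)"
    and "a \<in> closure (range D)" "b \<in> closure (range D)"
    and "\<And>u. inner (D u) a = inner (D u) b"
  shows "a = b"
proof -
  have "closure (range D) \<subseteq> {x. inner x (a - b) = 0}"
    by (rule closure_minimal) (auto simp: assms inner_diff_right intro!: closed_Collect_eq continuous_intros)
  then have "inner a (a - b) = 0" "inner b (a - b) = 0" using assms by auto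
  then have "inner (a - b) (a - b) = 0" by (simp only: inner_diff_left)
  then show ?thesis by simp
qed

text \<open>The adjoint \<open>K\<close> comes first: \<open>K y\<close> represents the functional
  \<open>\<lambda>u. inner (G u) y\<close>, which is dominated by \<open>norm (D u)\<close>.
  Choosing it in the closed range makes it unique, hence linear in y. Taking \<open>\<Gamma>\<close>
  as the adjoint of \<open>K\<close> yields an operator on the whole space, with no extension by
  continuity from the range of D.\<close>

lemma douglas_factorization:
  fixes D :: "'u::chilbert_space \<Rightarrow> 'v::chilbert_space" and G :: "'u \<Rightarrow> 'h::chilbert_space"
  assumes D: "bounded_clinear D" and G: "bounded_clinear G"
    and le: "\<And>u. norm (G u) \<le> norm (D u)"
  obtains \<Gamma> K where "bounded_clinear \<Gamma>" "bounded_clinear K"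
    "\<And>x y. cinner (\<Gamma> x) y = cinner x (K y)" "\<And>x. norm (\<Gamma> x) \<le> norm x"
    "\<And>y. K y \<in> closure (range D)" "\<And>u. \<Gamma> (D u) = G u"
proof -
  have "\<exists>k\<in>closure (range D). \<forall>u. inner (G u) y = inner (D u) k" for y
  proof (rule riesz_representation_range[OF bounded_clinear_linear[OF D]])
    show "linear (\<lambda>u. inner (G u) y)"
      using bounded_clinear_linear[OF G] by (auto simp: linear_iff inner_add_left)
    show "\<bar>inner (G u) y\<bar> \<le> norm y * norm (D u)" for u
      using Cauchy_Schwarz_ineq2[of "G u" y] mult_right_mono[OF le[of u], of "norm y"]
      by (simp add: mult.commute)
  qed
  then obtain K where K: "\<And>y. K y \<in> closure (range D)"
    "\<And>u y. inner (G u) y = inner (D u) (K y)" by metis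
  have cK: "cinner (G u) y = cinner (D u) (K y)" for u y
    using K(2)[of u y] K(2)[of "\<i> *\<^sub>C u" y]
    by (intro complex_eqI)
      (simp_all add: Re_cinner Im_cinner bounded_clinear_scaleC[OF D] bounded_clinear_scaleC[OF G])
  have leK: "norm (K y) \<le> norm y" for y
  proof -
    \<comment> \<open>The estimate is clear on the range and survives the closure, where it may be
      applied to x = K y itself.\<close>
    have "closure (range D) \<subseteq> {x. inner x (K y) \<le> norm x * norm y}"
    proof (rule closure_minimal)
      have "inner (D u) (K y) \<le> norm (D u) * norm y" for u
        using norm_cauchy_schwarz[of "G u" y] mult_right_mono[OF le[of u], of "norm y"]
        by (simp add: K(2)[symmetric])
      then show "range D \<subseteq> {x. inner x (K y) \<le> norm x * norm y}" by auto
      show "closed {x. inner x (K y) \<le> norm x * norm y}"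
        by (intro closed_Collect_le continuous_intros)
    qed
    then have "inner (K y) (K y) \<le> norm (K y) * norm y" using K(1) by blast
    then show ?thesis
      by (cases "K y = 0") (simp_all add: dot_square_norm power2_eq_square)
  qed
  have lin: "bounded_clinear K"
  proof (rule bounded_clinearI[of _ 1])
    show "K (x + y) = K x + K y" for x y
      by (rule closure_range_eqI[OF D K(1) closure_range_add[OF D K(1) K(1)]])
        (simp add: inner_add_right K(2)[symmetric])
    show "K (c *\<^sub>C x) = c *\<^sub>C K x" for c x
      by (rule closure_range_eqI[OF D K(1) closure_range_scaleC[OF D K(1)]])
        (simp add: inner_eq_Re_cinner cinner_scaleC_right cK[symmetric])
  qed (simp add: leK)
  define \<Gamma> where "\<Gamma> = cadjoint K"
  have adj: "cinner (\<Gamma> x) y = cinner x (K y)" for x y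
    unfolding \<Gamma>_def by (metis cinner_cadjoint[OF lin] cinner_commute)
  show thesis
  proof (rule that[of \<Gamma> K])
    show "bounded_clinear \<Gamma>" unfolding \<Gamma>_def by (rule bounded_clinear_cadjoint[OF lin])
    show "norm (\<Gamma> x) \<le> norm x" for x unfolding \<Gamma>_def by (rule norm_cadjoint_le[OF lin leK])
    show "\<Gamma> (D u) = G u" for u
    proof (rule cinner_eqI)
      fix y
      have "inner (\<Gamma> (D u)) y = inner (G u) y"
        by (simp add: inner_eq_Re_cinner adj cK)
      then show "inner y (\<Gamma> (D u)) = inner y (G u)" by (simp only: inner_commute)
    qed
  qed (fact lin adj K(1))+
qed

section \<open>Resolvents of contractions\<close>

definition resolvent :: "('a::complex_inner \<Rightarrow> 'a) \<Rightarrow> complex \<Rightarrow> 'a \<Rightarrow> 'a" where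
  "resolvent B z = inv (\<lambda>x. x - z *\<^sub>C B x)"

context
  fixes B :: "'a::chilbert_space \<Rightarrow> 'a" and z :: complex
  assumes B: "contraction B" and z: "z \<in> ball 0 1"
begin

lemma bij_resolvent: "bij (\<lambda>x. x - z *\<^sub>C B x)"
proof -
  \<comment> \<open>A zero component is added because \<open>bij_betw_resolvent\<close> speaks of
    maps into a direct sum.\<close>
  have "contraction (\<lambda>x. (0::complex, B x))"
    using B by (auto simp: contraction_iff scaleC_prod_def scaleC.zero_right norm_Pair
        bounded_clinear_add bounded_clinear_scaleC intro!: bounded_clinearI[of _ 1])
  then have "contraction_on UNIV (UNIV \<times> UNIV) (\<lambda>x. (0::complex, B x))"
    by (simp add: contraction_on_UNIV)
  from bij_betw_resolvent[OF _ _ _ _ this z] show ?thesis by simp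
qed

lemma resolvent_eq: "resolvent B z y - z *\<^sub>C B (resolvent B z y) = y"
  using surj_f_inv_f[OF bij_is_surj[OF bij_resolvent], of y] by (simp add: resolvent_def)

lemma resolvent_eqI: "x - z *\<^sub>C B x = y \<Longrightarrow> resolvent B z y = x"
  using inv_f_f[OF bij_is_inj[OF bij_resolvent], of x] by (simp add: resolvent_def)

lemma bounded_clinear_resolvent: "bounded_clinear (resolvent B z)"
  and norm_resolvent: "norm (resolvent B z y) \<le> norm y / (1 - cmod z)"
proof -
  note lin = contractionD(1)[OF B]
  show bound: "norm (resolvent B z y) \<le> norm y / (1 - cmod z)" for y
  proof -
    have "norm (resolvent B z y) \<le> norm y + norm (z *\<^sub>C B (resolvent B z y))"
      using norm_triangle_sub[of "resolvent B z y" "z *\<^sub>C B (resolvent B z y)"] resolvent_eq[of y]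
      by (simp add: add.commute)
    also have "\<dots> \<le> norm y + cmod z * norm (resolvent B z y)"
      using contractionD(2)[OF B] by (auto simp: norm_scaleC intro!: mult_left_mono)
    finally show ?thesis using z by (simp add: field_simps)
  qed
  show "bounded_clinear (resolvent B z)"
  proof (rule bounded_clinearI[of _ "1 / (1 - cmod z)"])
    show "resolvent B z (x + y) = resolvent B z x + resolvent B z y" for x y
    proof (rule resolvent_eqI)
      have "resolvent B z x + resolvent B z y - z *\<^sub>C B (resolvent B z x + resolvent B z y)
          = (resolvent B z x - z *\<^sub>C B (resolvent B z x))
            + (resolvent B z y - z *\<^sub>C B (resolvent B z y))"
        by (simp add: bounded_clinear_add[OF lin] scaleC_add_right)
      then show "resolvent B z x + resolvent B z y
          - z *\<^sub>C B (resolvent B z x + resolvent B z y) = x + y"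
        by (simp only: resolvent_eq)
    qed
    show "resolvent B z (c *\<^sub>C x) = c *\<^sub>C resolvent B z x" for c x
    proof (rule resolvent_eqI)
      have "c *\<^sub>C resolvent B z x - z *\<^sub>C B (c *\<^sub>C resolvent B z x)
          = c *\<^sub>C (resolvent B z x - z *\<^sub>C B (resolvent B z x))"
        by (simp add: bounded_clinear_scaleC[OF lin] scaleC.diff_right scaleC_scaleC mult.commute)
      then show "c *\<^sub>C resolvent B z x - z *\<^sub>C B (c *\<^sub>C resolvent B z x) = c *\<^sub>C x"
        by (simp only: resolvent_eq)
    qed
  qed (use bound in simp)
qed

end

lemma resolvent_identity:
  fixes B :: "'a::chilbert_space \<Rightarrow> 'a"
  assumes B: "contraction B" and w: "w \<in> ball 0 1" and z: "z \<in> ball 0 1"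
  shows "resolvent B w y - resolvent B z y = (w - z) *\<^sub>C resolvent B w (B (resolvent B z y))"
proof -
  note lin = bounded_clinear_resolvent[OF B w]
  have "y - (resolvent B z y - w *\<^sub>C B (resolvent B z y)) = (w - z) *\<^sub>C B (resolvent B z y)"
    using resolvent_eq[OF B z, of y] by (simp add: scaleC.diff_left algebra_simps)
  then have "resolvent B w (y - (resolvent B z y - w *\<^sub>C B (resolvent B z y)))
      = resolvent B w ((w - z) *\<^sub>C B (resolvent B z y))" by simp
  then show ?thesis
    using resolvent_eqI[OF B w refl, of "resolvent B z y"]
    by (simp add: bounded_clinear_diff[OF lin] bounded_clinear_scaleC[OF lin])
qed

section \<open>The Schur function of a contractive observability operator\<close>

lemma onorm_on_le:
  assumes "0 \<in> S" "\<And>x. x \<in> S \<Longrightarrow> norm (T x) \<le> K * norm x" "K \<ge> 0"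
  shows "0 \<le> onorm_on S T" "onorm_on S T \<le> K"
proof -
  have le: "norm (T x) / norm x \<le> K" if "x \<in> S" for x
    using assms(2)[OF that] assms(3) by (cases "x = 0") (auto simp: divide_le_eq)
  then show "onorm_on S T \<le> K"
    unfolding onorm_on_def using assms(1) by (intro cSUP_least) auto
  \<comment> \<open>The quotient at 0 is 0 by the convention for division by zero, so the supremum
    is nonnegative.\<close>
  have "norm (T 0) / norm (0::'a) \<le> onorm_on S T"
    unfolding onorm_on_def by (rule cSUP_upper[OF assms(1)]) (use le in \<open>auto simp: bdd_above_def\<close>)
  then show "0 \<le> onorm_on S T" by simp
qed

lemma onorm_on_upper:
  assumes "bounded_clinear_on S R T" "x \<in> S"
  shows "norm (T x) \<le> onorm_on S T * norm x"
proof -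
  obtain K where K: "\<And>x. x \<in> S \<Longrightarrow> norm (T x) \<le> K * norm x"
    using assms(1) unfolding bounded_clinear_on_def by blast
  show ?thesis
  proof (cases "x = 0")
    case True
    then show ?thesis using K[OF assms(2)] by simp
  next
    case False
    \<comment> \<open>The maximum is taken because K may be negative when S is trivial, whereas the
      quotient at 0 is 0.\<close>
    have "norm (T x) / norm x \<le> max K 0" if "x \<in> S" for x
      using K[OF that] by (cases "x = 0") (auto simp: divide_le_eq le_max_iff_disj)
    then have "bdd_above ((\<lambda>x. norm (T x) / norm x) ` S)" by (rule bdd_aboveI2)
    then have "norm (T x) / norm x \<le> onorm_on S T"
      unfolding onorm_on_def by (rule cSUP_upper[OF assms(2)])
    then show ?thesis using False by (simp add: divide_le_eq)
  qed
qed

text \<open>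
  Here \<open>E\<close> and \<open>T\<close> form an isometric column (in the application, evaluation at position 0 and the
  backward shift), \<open>\<Gamma>\<close> is a contraction with adjoint \<open>K\<close>, and \<open>V z w = (E \<xi>, K (T \<xi>))\<close> where \<open>\<xi>\<close>
  is the state solving \<open>\<xi> = \<Gamma> w + z (I - \<Gamma> K) T \<xi>\<close>. Substituting \<open>w = p + z K T \<xi>\<close> turns this into
  \<open>\<xi> = \<Gamma> p + z T \<xi>\<close>, so that \<open>E (I - z T)\<^sup>-\<^sup>1 \<Gamma>\<close> is the transfer function to be represented.
\<close>

locale observable_system =
  fixes \<Gamma> :: "'u::chilbert_space \<Rightarrow> 's::chilbert_space" and K :: "'s \<Rightarrow> 'u"
    and T :: "'s \<Rightarrow> 's" and E :: "'s \<Rightarrow> 'y::chilbert_space" and S :: "'u set"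
  assumes lin_\<Gamma>: "bounded_clinear \<Gamma>" and lin_K: "bounded_clinear K"
    and lin_T: "bounded_clinear T" and lin_E: "bounded_clinear E"
    and adjoint: "cinner (\<Gamma> x) \<xi> = cinner x (K \<xi>)" and norm_\<Gamma>: "norm (\<Gamma> x) \<le> norm x"
    and isometric: "(norm (E \<xi>))\<^sup>2 + (norm (T \<xi>))\<^sup>2 = (norm \<xi>)\<^sup>2"
    and K_in: "K \<xi> \<in> S"
    and S: "closed S" "0 \<in> S" "\<And>x y. x \<in> S \<Longrightarrow> y \<in> S \<Longrightarrow> x + y \<in> S"
      "\<And>c x. x \<in> S \<Longrightarrow> c *\<^sub>C x \<in> S"
begin

definition "B \<xi> = T \<xi> - \<Gamma> (K (T \<xi>))"

definition "out \<xi> = (E \<xi>, K (T \<xi>))"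

definition "V z w = out (resolvent B z (\<Gamma> w))"

lemma inner_adjoint: "inner (\<Gamma> x) \<xi> = inner x (K \<xi>)"
  by (simp add: inner_eq_Re_cinner adjoint)

lemma norm_K: "norm (K \<xi>) \<le> norm \<xi>"
  using bounded_clinear_adjointI(2)[of \<Gamma> K 1] adjoint norm_\<Gamma> by simp

lemma norm_T: "norm (T \<xi>) \<le> norm \<xi>"
proof -
  have "(norm (T \<xi>))\<^sup>2 \<le> (norm \<xi>)\<^sup>2"
    using isometric[of \<xi>] zero_le_power2[of "norm (E \<xi>)"] by linarith
  then show ?thesis by (rule power2_le_imp_le) simp
qed

lemma contraction_T: "contraction T"
  by (simp add: contraction_iff lin_T norm_T)

text \<open>With \<eta> = T \<xi>, the cross term is -2 <\<Gamma> K \<eta>, \<eta>> = -2 |K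
  \<eta>|^2, which outweighs |\<Gamma> K \<eta>|^2. Hence the state equation with feedback is
  solvable for every z in the disc.\<close>

lemma contraction_B: "contraction B"
  unfolding contraction_iff
proof (intro conjI allI)
  show "bounded_clinear B"
    using bounded_clinear_diff_op[OF lin_T
        bounded_clinear_compose[OF lin_\<Gamma> bounded_clinear_compose[OF lin_K lin_T]]]
    by (simp add: B_def[abs_def])
  fix \<xi>
  define \<eta> where "\<eta> = T \<xi>"
  have "(norm (B \<xi>))\<^sup>2 = (norm \<eta>)\<^sup>2 - 2 * inner (\<Gamma> (K \<eta>)) \<eta> + (norm (\<Gamma> (K \<eta>)))\<^sup>2"
    by (simp add: B_def \<eta>_def power2_norm_eq_inner inner_diff_left inner_diff_right inner_commute)
  also have "\<dots> \<le> (norm \<eta>)\<^sup>2 - 2 * (norm (K \<eta>))\<^sup>2 + (norm (K \<eta>))\<^sup>2"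
    using norm_\<Gamma>[of "K \<eta>"] by (simp add: inner_adjoint dot_square_norm power_mono)
  also have "\<dots> \<le> (norm \<xi>)\<^sup>2"
    using power_mono[OF norm_T[of \<xi>] norm_ge_zero, of 2] zero_le_power2[of "norm (K \<eta>)"]
    unfolding \<eta>_def by linarith
  finally show "norm (B \<xi>) \<le> norm \<xi>" by (rule power2_le_imp_le) simp
qed

lemma bounded_clinear_out: "bounded_clinear out"
  and norm_out: "norm (out \<xi>) \<le> norm \<xi>"
proof -
  show le: "norm (out \<xi>) \<le> norm \<xi>" for \<xi>
  proof (rule power2_le_imp_le)
    have "(norm (K (T \<xi>)))\<^sup>2 \<le> (norm (T \<xi>))\<^sup>2" by (intro power_mono norm_K) simp
    moreover have "(norm (out \<xi>))\<^sup>2 = (norm (E \<xi>))\<^sup>2 + (norm (K (T \<xi>)))\<^sup>2"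
      by (simp add: out_def norm_Pair)
    ultimately show "(norm (out \<xi>))\<^sup>2 \<le> (norm \<xi>)\<^sup>2"
      using isometric[of \<xi>] by linarith
  qed simp
  show "bounded_clinear out"
    by (rule bounded_clinearI[of _ 1])
      (use le in \<open>simp_all add: out_def scaleC_prod_def bounded_clinear_add[OF lin_E]
        bounded_clinear_add[OF lin_K] bounded_clinear_add[OF lin_T] bounded_clinear_scaleC[OF lin_E]
        bounded_clinear_scaleC[OF lin_K] bounded_clinear_scaleC[OF lin_T]\<close>)
qed

context
  fixes z :: complex
  assumes z: "z \<in> ball 0 1"
begin

lemma bounded_clinear_V: "bounded_clinear (V z)"
  using bounded_clinear_compose[OF bounded_clinear_out
      bounded_clinear_compose[OF bounded_clinear_resolvent[OF contraction_B z] lin_\<Gamma>]]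
  by (simp add: V_def[abs_def])

text \<open>An energy balance: contractivity of \<Gamma> and the completed square give |\<xi>|^2
  \<le> |w|^2 + |\<eta>|^2 - |K \<eta>|^2. The last difference is |z|^2 times a nonnegative number,
  so |z| may be replaced by 1; then the isometry of the column turns the estimate into one for the
  output.\<close>

lemma norm_V: "norm (V z w) \<le> norm w"
proof (rule power2_le_imp_le)
  define \<xi> where "\<xi> = resolvent B z (\<Gamma> w)"
  define \<eta> where "\<eta> = z *\<^sub>C T \<xi>"
  \<comment> \<open>The external input, from which w arises by adding the feedback.\<close>
  define p where "p = w - K \<eta>"
  have "\<xi> = \<Gamma> w + z *\<^sub>C B \<xi>"
    using resolvent_eq[OF contraction_B z, of "\<Gamma> w"] by (simp add: \<xi>_def diff_eq_eq)
  then have \<xi>: "\<xi> = \<eta> + \<Gamma> p"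
    by (simp add: B_def \<eta>_def p_def scaleC.diff_right bounded_clinear_diff[OF lin_\<Gamma>]
        bounded_clinear_scaleC[OF lin_\<Gamma>] bounded_clinear_scaleC[OF lin_K] algebra_simps)
  have "(norm \<xi>)\<^sup>2 = (norm \<eta>)\<^sup>2 + 2 * inner (\<Gamma> p) \<eta> + (norm (\<Gamma> p))\<^sup>2"
    by (simp add: \<xi> power2_norm_eq_inner inner_add_left inner_add_right inner_commute)
  also have "\<dots> \<le> (norm \<eta>)\<^sup>2 + (2 * inner p (K \<eta>) + (norm p)\<^sup>2)"
    using norm_\<Gamma>[of p] by (simp add: inner_adjoint power_mono)
  also have "2 * inner p (K \<eta>) + (norm p)\<^sup>2 = (norm w)\<^sup>2 - (norm (K \<eta>))\<^sup>2"
    by (simp add: p_def power2_norm_eq_inner inner_diff_left inner_diff_right inner_commute)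
  finally have "(norm \<xi>)\<^sup>2 \<le> (norm w)\<^sup>2 + ((norm \<eta>)\<^sup>2 - (norm (K \<eta>))\<^sup>2)" by simp
  also have "(norm \<eta>)\<^sup>2 - (norm (K \<eta>))\<^sup>2 = (cmod z)\<^sup>2 * ((norm (T \<xi>))\<^sup>2 - (norm (K (T \<xi>)))\<^sup>2)"
    by (simp add: \<eta>_def bounded_clinear_scaleC[OF lin_K] norm_scaleC power_mult_distrib
        right_diff_distrib)
  also have "\<dots> \<le> (norm (T \<xi>))\<^sup>2 - (norm (K (T \<xi>)))\<^sup>2"
    using z power_mono[OF norm_K[of "T \<xi>"], of 2] by (intro mult_left_le_one_le) (auto simp: power_le_one)
  finally show "(norm (V z w))\<^sup>2 \<le> (norm w)\<^sup>2"
    using isometric[of \<xi>] by (simp add: V_def out_def \<xi>_def[symmetric] norm_Pair)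
qed simp

lemma contraction_on_V: "contraction_on S (UNIV \<times> S) (V z)"
  unfolding contraction_on_def
proof
  show "bounded_clinear_on S (UNIV \<times> S) (V z)"
    unfolding bounded_clinear_on_def
  proof (intro conjI ballI allI)
    show "V z ` S \<subseteq> UNIV \<times> S" by (auto simp: V_def out_def K_in)
    show "\<exists>K. \<forall>x\<in>S. norm (V z x) \<le> K * norm x" by (intro exI[of _ 1]) (simp add: norm_V)
  qed (simp_all add: bounded_clinear_add[OF bounded_clinear_V]
      bounded_clinear_scaleC[OF bounded_clinear_V])
  show "onorm_on S (V z) \<le> 1" by (rule onorm_on_le) (simp_all add: norm_V S)
qed

lemma transfer_function:
  assumes p: "p \<in> S"
  shows "fst (V z (inv_into S (\<lambda>w. w - z *\<^sub>C snd (V z w)) p)) = E (resolvent T z (\<Gamma> p))"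
proof -
  define \<xi> where "\<xi> = resolvent T z (\<Gamma> p)"
  define w where "w = p + z *\<^sub>C K (T \<xi>)"
  have "\<xi> - z *\<^sub>C B \<xi> = \<Gamma> p + \<Gamma> (z *\<^sub>C K (T \<xi>))"
    using resolvent_eq[OF contraction_T z, of "\<Gamma> p"]
    by (simp add: \<xi>_def B_def scaleC.diff_right bounded_clinear_scaleC[OF lin_\<Gamma>])
  then have \<xi>: "resolvent B z (\<Gamma> w) = \<xi>"
    by (intro resolvent_eqI[OF contraction_B z]) (simp add: w_def bounded_clinear_add[OF lin_\<Gamma>])
  have "w \<in> S" using p by (simp add: w_def S K_in)
  moreover have "w - z *\<^sub>C snd (V z w) = p" unfolding V_def \<xi> by (simp add: out_def w_def)
  moreover have "inj_on (\<lambda>w. w - z *\<^sub>C snd (V z w)) S"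
    using bij_betw_resolvent[OF S contraction_on_V z] by (rule bij_betw_imp_inj_on)
  ultimately have "inv_into S (\<lambda>w. w - z *\<^sub>C snd (V z w)) p = w"
    by (metis (no_types, lifting) inv_into_f_f)
  then show ?thesis by (simp add: V_def \<xi> out_def \<xi>_def)
qed

end

text \<open>The derivative at z is out R(z) B R(z) \<Gamma>, where R is the resolvent. A first use
  of the resolvent identity computes the difference quotient, a second one the error (w - z) out
  R(w) B R(z) B R(z) \<Gamma>.\<close>

lemma V_schur_class: "V \<in> schur_class S (UNIV \<times> S)"
  unfolding schur_class_def
proof (intro CollectI conjI ballI)
  fix z :: complex assume z: "z \<in> ball 0 1"
  show "contraction_on S (UNIV \<times> S) (V z)" using z by (rule contraction_on_V)
  let ?R = "resolvent B"
  define L where "L x = out (?R z (B (?R z (\<Gamma> x))))" for x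
  have "bounded_clinear L"
    unfolding L_def[abs_def]
    by (intro bounded_clinear_compose[OF bounded_clinear_out]
        bounded_clinear_compose[OF bounded_clinear_resolvent[OF contraction_B z]]
        bounded_clinear_compose[OF contractionD(1)[OF contraction_B]] lin_\<Gamma>)
  then obtain C where C: "\<And>x. norm (L x) \<le> C * norm x" and lin_L: "bounded_clinear L"
    using bounded_clinear_bound by blast
  have "bounded_clinear_on S (UNIV \<times> S) L"
    unfolding bounded_clinear_on_def
    by (intro conjI exI[of _ C])
      (auto simp: C bounded_clinear_add[OF lin_L] bounded_clinear_scaleC[OF lin_L],
        auto simp: L_def out_def K_in)
  moreover have "((\<lambda>w. onorm_on S (\<lambda>x. inverse (w - z) *\<^sub>C (V w x - V z x) - L x)) \<longlongrightarrow> 0) (at z)"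
  proof -
    \<comment> \<open>One factor 1 / (1 - |w|) for the resolvent at w and one 1 / (1 - |z|) for each
      of the two resolvents at z in the error term.\<close>
    define b where "b w = cmod (w - z) / ((1 - cmod w) * (1 - cmod z)\<^sup>2)" for w
    have "(b \<longlongrightarrow> cmod (z - z) / ((1 - cmod z) * (1 - cmod z)\<^sup>2)) (at z)"
      unfolding b_def[abs_def] using z by (intro tendsto_intros) auto
    then have b0: "(b \<longlongrightarrow> 0) (at z)" by simp
    have "0 \<le> onorm_on S (\<lambda>x. inverse (w - z) *\<^sub>C (V w x - V z x) - L x)
        \<and> onorm_on S (\<lambda>x. inverse (w - z) *\<^sub>C (V w x - V z x) - L x) \<le> b w"
      if w: "w \<in> ball 0 1 - {z}" for w
    proof -
      have w1: "w \<in> ball 0 1" "w \<noteq> z" using w by auto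
      have bw: "b w \<ge> 0" using w1 z by (auto simp: b_def)
      have "norm (inverse (w - z) *\<^sub>C (V w x - V z x) - L x) \<le> b w * norm x" for x
      proof -
        define y where "y = B (?R z (\<Gamma> x))"
        have V: "V w x - V z x = (w - z) *\<^sub>C out (?R w y)"
          unfolding V_def bounded_clinear_diff[OF bounded_clinear_out, symmetric]
            resolvent_identity[OF contraction_B w1(1) z] y_def
          by (rule bounded_clinear_scaleC[OF bounded_clinear_out])
        have "inverse (w - z) *\<^sub>C (V w x - V z x) = out (?R w y)"
          unfolding V using w1(2) by (simp add: scaleC_scaleC)
        then have "inverse (w - z) *\<^sub>C (V w x - V z x) - L x
            = out ((w - z) *\<^sub>C ?R w (B (?R z y)))"
          unfolding L_def y_def[symmetric] resolvent_identity[OF contraction_B w1(1) z, symmetric]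
          by (simp add: bounded_clinear_diff[OF bounded_clinear_out])
        then have "norm (inverse (w - z) *\<^sub>C (V w x - V z x) - L x)
            \<le> norm ((w - z) *\<^sub>C ?R w (B (?R z y)))"
          using norm_out by simp
        also have "\<dots> \<le> cmod (w - z) * (norm x / (1 - cmod z) / (1 - cmod z) / (1 - cmod w))"
          unfolding norm_scaleC
        proof (intro mult_left_mono norm_ge_zero)
          have "norm (?R w (B (?R z y))) \<le> norm (B (?R z y)) / (1 - cmod w)"
            by (rule norm_resolvent[OF contraction_B w1(1)])
          also have "norm (B (?R z y)) \<le> norm (?R z y)" by (rule contractionD(2)[OF contraction_B])
          also have "norm (?R z y) \<le> norm y / (1 - cmod z)"
            by (rule norm_resolvent[OF contraction_B z])
          also have "norm y \<le> norm (?R z (\<Gamma> x))"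
            unfolding y_def by (rule contractionD(2)[OF contraction_B])
          also have "\<dots> \<le> norm (\<Gamma> x) / (1 - cmod z)" by (rule norm_resolvent[OF contraction_B z])
          also have "norm (\<Gamma> x) \<le> norm x" by (rule norm_\<Gamma>)
          finally show "norm (?R w (B (?R z y))) \<le> norm x / (1 - cmod z) / (1 - cmod z) / (1 - cmod w)"
            using z w1 by (simp add: divide_right_mono)
        qed
        also have "\<dots> = b w * norm x" by (simp add: b_def power2_eq_square mult_ac)
        finally show ?thesis .
      qed
      then show ?thesis by (intro conjI onorm_on_le[OF S(2) _ bw])
    qed
    then have "\<forall>\<^sub>F w in at z. 0 \<le> onorm_on S (\<lambda>x. inverse (w - z) *\<^sub>C (V w x - V z x) - L x)
        \<and> onorm_on S (\<lambda>x. inverse (w - z) *\<^sub>C (V w x - V z x) - L x) \<le> b w"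
      using eventually_at_in_open[OF open_ball z] by (rule eventually_mono[rotated])
    then show ?thesis
      by (intro tendsto_sandwich[OF _ _ tendsto_const b0]) (auto elim: eventually_mono)
  qed
  ultimately show "\<exists>L. bounded_clinear_on S (UNIV \<times> S) L \<and>
      ((\<lambda>w. onorm_on S (\<lambda>x. inverse (w - z) *\<^sub>C (V w x - V z x) - L x)) \<longlongrightarrow> 0) (at z)"
    by blast
qed

end

section \<open>Hilbert space valued analytic functions on the disc\<close>

definition disc_analytic :: "(complex \<Rightarrow> 'a::complex_inner) \<Rightarrow> bool" where
  "disc_analytic f \<longleftrightarrow> (\<forall>z\<in>ball 0 1. \<exists>D. has_cderiv f D z)"

lemma disc_analyticE:
  assumes "disc_analytic f" "z \<in> ball 0 1"
  obtains D where "has_cderiv f D z"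
  using assms unfolding disc_analytic_def by blast

lemma has_cderiv_imp_isCont:
  assumes "has_cderiv f D z"
  shows "isCont f z"
proof -
  have lim: "((\<lambda>w. (w - z) *\<^sub>C (inverse (w - z) *\<^sub>C (f w - f z))) \<longlongrightarrow> (z - z) *\<^sub>C D) (at z)"
    using assms unfolding has_cderiv_def by (intro scaleC.tendsto tendsto_intros)
  have "((\<lambda>w. f w - f z) \<longlongrightarrow> (z - z) *\<^sub>C D) (at z)"
  proof (rule Lim_transform_eventually[OF lim])
    show "\<forall>\<^sub>F w in at z. (w - z) *\<^sub>C (inverse (w - z) *\<^sub>C (f w - f z)) = f w - f z"
      unfolding eventually_at_filter by (rule always_eventually) (simp add: scaleC_scaleC)
  qed
  then show ?thesis by (simp add: isCont_def LIM_zero_iff)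
qed

lemma disc_analytic_continuous_on: "disc_analytic f \<Longrightarrow> continuous_on (ball 0 1) f"
  by (intro continuous_at_imp_continuous_on ballI) (metis disc_analyticE has_cderiv_imp_isCont)

lemma disc_analytic_circle:
  assumes "disc_analytic f" "0 \<le> r" "r < 1"
  shows "continuous_on {0..2*pi} (\<lambda>t. f (complex_of_real r * cis t))"
  by (rule continuous_on_compose2[OF disc_analytic_continuous_on[OF assms(1)]])
    (use assms in \<open>auto intro!: continuous_intros simp: norm_mult\<close>)

text \<open>The passage to scalar functions, through which Cauchy's formula and Taylor's theorem
  become available.\<close>

lemma disc_analytic_cinner:
  assumes "disc_analytic f"
  shows "(\<lambda>z. cinner (f z) y) holomorphic_on ball 0 1"
proof (rule holomorphic_onI)
  fix z :: complex assume "z \<in> ball 0 1"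
  then obtain D where D: "has_cderiv f D z" using assms disc_analyticE by blast
  have "((\<lambda>w. cinner (inverse (w - z) *\<^sub>C (f w - f z)) y) \<longlongrightarrow> cinner D y) (at z)"
    using D unfolding has_cderiv_def by (intro cinner.tendsto tendsto_intros)
  then have "((\<lambda>z. cinner (f z) y) has_field_derivative cinner D y) (at z)"
    by (simp add: has_field_derivative_iff cinner_scaleC_left cinner.diff_left divide_inverse mult.commute)
  then show "(\<lambda>z. cinner (f z) y) field_differentiable at z within ball 0 1"
    using field_differentiable_at_within field_differentiable_def by blast
qed

text \<open>Cauchy's formula for the nth derivative, parametrized as a Fourier integral over the
  circle of radius r.\<close>

lemma holomorphic_fourier_coeff:
  assumes f: "f holomorphic_on ball 0 1" and r: "0 < r" "r < 1"
  shows "((\<lambda>t. cis (- (real n * t)) * f (complex_of_real r * cis t)) has_integral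
      complex_of_real (2 * pi * r ^ n) * ((deriv ^^ n) f 0 / fact n)) {0..2*pi}"
proof -
  have sub: "cball 0 r \<subseteq> ball (0::complex) 1" "ball 0 r \<subseteq> ball (0::complex) 1"
    using r by (auto simp: subset_iff)
  have "((\<lambda>u. f u / (u - 0) ^ Suc n) has_contour_integral
      contour_integral (circlepath 0 r) (\<lambda>u. f u / (u - 0) ^ Suc n)) (circlepath 0 r)"
    by (intro has_contour_integral_integral Cauchy_higher_derivative_integral_circlepath(1))
      (use r sub in \<open>auto intro: holomorphic_on_subset[OF f] holomorphic_on_imp_continuous_on[OF f]
         continuous_on_subset holomorphic_on_imp_continuous_on\<close>)
  also have "contour_integral (circlepath 0 r) (\<lambda>u. f u / (u - 0) ^ Suc n)
      = 2 * pi * \<i> * ((deriv ^^ n) f 0 / fact n)"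
    by (subst Cauchy_higher_derivative_integral_circlepath(2)[of 0 r f 0 n])
      (use r sub in \<open>auto intro: holomorphic_on_subset[OF f]
         continuous_on_subset[OF holomorphic_on_imp_continuous_on[OF f]]\<close>)
  finally have "((\<lambda>t. f (0 + r * cis t) / (r * cis t) ^ Suc n * r * \<i> * cis t) has_integral
      2 * pi * \<i> * ((deriv ^^ n) f 0 / fact n)) {0..2*pi}"
    unfolding circlepath_def using has_contour_integral_part_circlepath_iff[of 0 "2*pi"] by simp
  \<comment> \<open>The factor - i cancels the i from differentiating r cis t, and r^n cancels the
    power of r in the denominator.\<close>
  from has_integral_mult_right[OF this, of "- \<i> * r ^ n"]
  have "((\<lambda>t. - \<i> * r ^ n * (f (0 + r * cis t) / (r * cis t) ^ Suc n * r * \<i> * cis t)) has_integral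
      complex_of_real (2 * pi * r ^ n) * ((deriv ^^ n) f 0 / fact n)) {0..2*pi}"
    by (simp add: mult_ac)
  moreover have "- \<i> * r ^ n * (f (0 + r * cis t) / (r * cis t) ^ Suc n * r * \<i> * cis t)
      = cis (- (real n * t)) * f (r * cis t)" for t
  proof -
    have "cis (- (real n * t)) = inverse (cis t ^ n)" unfolding Complex.DeMoivre by simp
    then show ?thesis using r by (simp add: field_simps)
  qed
  ultimately show ?thesis by simp
qed

text \<open>Scalar derivatives alone do not produce a coefficient vector; the vector-valued Fourier
  integral does. Testing it against y identifies it with the scalar coefficients and shows how it
  depends on r.\<close>

lemma disc_analytic_taylor_integral:
  fixes f :: "complex \<Rightarrow> 'a::chilbert_space"
  assumes f: "disc_analytic f"
  shows "\<exists>a. (\<forall>n r. 0 < r \<longrightarrow> r < 1 \<longrightarrow>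
        ((\<lambda>t. cis (- (real n * t)) *\<^sub>C f (complex_of_real r * cis t)) has_integral
          (2 * pi * r ^ n) *\<^sub>R a n) {0..2*pi})
      \<and> (\<forall>n y. cinner (a n) y = (deriv ^^ n) (\<lambda>z. cinner (f z) y) 0 / fact n)"
proof -
  define I where "I n r = integral {0..2*pi} (\<lambda>t. cis (- (real n * t)) *\<^sub>C f (complex_of_real r * cis t))" for n r
  define c where "c n y = (deriv ^^ n) (\<lambda>z. cinner (f z) y) 0 / fact n" for n y
  have I: "((\<lambda>t. cis (- (real n * t)) *\<^sub>C f (complex_of_real r * cis t)) has_integral I n r) {0..2*pi}"
    if "0 < r" "r < 1" for n r
    unfolding I_def using that
    by (intro integrable_integral integrable_continuous_real scaleC.continuous_on
        disc_analytic_circle[OF f] continuous_intros) auto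
  have cI: "cinner (I n r) y = complex_of_real (2 * pi * r ^ n) * c n y" if r: "0 < r" "r < 1" for n r y
  proof (rule has_integral_unique)
    show "((\<lambda>t. cinner (cis (- (real n * t)) *\<^sub>C f (complex_of_real r * cis t)) y) has_integral
        cinner (I n r) y) {0..2*pi}"
      using has_integral_linear[OF I[OF r] cinner.bounded_linear_left] by (simp add: o_def)
    show "((\<lambda>t. cinner (cis (- (real n * t)) *\<^sub>C f (complex_of_real r * cis t)) y) has_integral
        complex_of_real (2 * pi * r ^ n) * c n y) {0..2*pi}"
      unfolding cinner_scaleC_left c_def
      by (rule holomorphic_fourier_coeff[OF disc_analytic_cinner[OF f] r])
  qed
  \<comment> \<open>The radius 1/2 is arbitrary; after rescaling every radius gives the same
    vector.\<close>
  define a where "a n = inverse (2 * pi * (1/2) ^ n) *\<^sub>R I n (1/2)" for n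
  have ca: "cinner (a n) y = c n y" for n y
    using cI[of "1/2" n y]
    by (simp add: a_def scaleR_eq_scaleC cinner_scaleC_left field_simps)
  have "I n r = (2 * pi * r ^ n) *\<^sub>R a n" if r: "0 < r" "r < 1" for n r
  proof (rule cinner_eqI)
    fix y
    have "inner (I n r) y = inner ((2 * pi * r ^ n) *\<^sub>R a n) y"
      by (simp add: inner_eq_Re_cinner scaleR_eq_scaleC cinner_scaleC_left ca cI[OF r] del: of_real_mult)
    then show "inner y (I n r) = inner y ((2 * pi * r ^ n) *\<^sub>R a n)" by (simp only: inner_commute)
  qed
  then have "((\<lambda>t. cis (- (real n * t)) *\<^sub>C f (complex_of_real r * cis t)) has_integral
      (2 * pi * r ^ n) *\<^sub>R a n) {0..2*pi}" if "0 < r" "r < 1" for n r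
    using I[OF that] that by simp
  then show ?thesis using ca[unfolded c_def] by (intro exI[of _ a]) simp
qed

text \<open>Absolute convergence is phrased through the real series with coefficients
  \<open>norm (a n)\<close>, negative x included, since this is the form in which
  \<open>termdiff_converges\<close> accepts it.\<close>

definition has_power_series :: "(complex \<Rightarrow> 'a::complex_inner) \<Rightarrow> (nat \<Rightarrow> 'a) \<Rightarrow> bool" where
  "has_power_series f a \<longleftrightarrow> (\<forall>x::real. \<bar>x\<bar> < 1 \<longrightarrow> summable (\<lambda>n. norm (a n) * x ^ n))
     \<and> (\<forall>z\<in>ball 0 1. (\<lambda>n. z ^ n *\<^sub>C a n) sums f z)"

text \<open>Cauchy estimates from the vector integrals give absolute convergence; the sum is then
  recognized as f by testing against each y.\<close>

lemma disc_analytic_has_power_series: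
  fixes f :: "complex \<Rightarrow> 'a::chilbert_space"
  assumes f: "disc_analytic f"
  obtains a where "has_power_series f a"
proof -
  obtain a where
    I: "\<forall>n r. 0 < r \<longrightarrow> r < 1 \<longrightarrow>
        ((\<lambda>t. cis (- (real n * t)) *\<^sub>C f (complex_of_real r * cis t)) has_integral
          (2 * pi * r ^ n) *\<^sub>R a n) {0..2*pi}"
    and c: "\<forall>n y. cinner (a n) y = (deriv ^^ n) (\<lambda>z. cinner (f z) y) 0 / fact n"
    using disc_analytic_taylor_integral[OF f] by (elim exE conjE) (rule that)
  have summable: "summable (\<lambda>n. norm (a n) * x ^ n)" if x: "\<bar>x\<bar> < 1" for x :: real
  proof -
    \<comment> \<open>Halfway between |x| and 1: the Cauchy estimate on this circle yields the
      convergent ratio |x| / r.\<close>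
    define r where "r = (1 + \<bar>x\<bar>) / 2"
    have r: "0 < r" "r < 1" "\<bar>x\<bar> < r" using x by (auto simp: r_def)
    have "bounded ((\<lambda>t. f (complex_of_real r * cis t)) ` {0..2*pi})"
      using r by (intro compact_imp_bounded compact_continuous_image disc_analytic_circle[OF f]) auto
    then obtain M where M: "M > 0" "\<And>t. t \<in> {0..2*pi} \<Longrightarrow> norm (f (complex_of_real r * cis t)) \<le> M"
      unfolding bounded_pos by blast
    have "norm (a n) * r ^ n \<le> M" for n
    proof -
      have "norm ((2 * pi * r ^ n) *\<^sub>R a n) \<le> M * measure lborel (cbox 0 (2*pi))"
        by (rule has_integral_bound[OF _ I[rule_format, OF r(1,2), of n, folded box_real(2)]])
          (use M in \<open>auto simp: norm_scaleC\<close>)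
      then show ?thesis using r by (simp add: abs_mult power_abs mult_ac)
    qed
    then have "norm (a n) \<le> M / r ^ n" for n using r by (simp add: field_simps)
    then have *: "norm (norm (a n) * x ^ n) \<le> M * (\<bar>x\<bar> / r) ^ n" for n
      using mult_right_mono[of "norm (a n)" "M / r ^ n" "\<bar>x\<bar> ^ n"]
      by (simp add: abs_mult power_abs power_divide)
    show ?thesis
      by (rule summable_comparison_test'[where g = "\<lambda>n. M * (\<bar>x\<bar> / r) ^ n" and N = 0])
        (use * r in \<open>auto intro!: summable_mult summable_geometric\<close>)
  qed
  have "(\<lambda>n. z ^ n *\<^sub>C a n) sums f z" if z: "z \<in> ball 0 1" for z
  proof -
    have "summable (\<lambda>n. z ^ n *\<^sub>C a n)"
      by (rule summable_norm_cancel) (use summable[of "cmod z"] z in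
        \<open>simp add: norm_scaleC norm_power mult.commute\<close>)
    then obtain s where s: "(\<lambda>n. z ^ n *\<^sub>C a n) sums s" unfolding summable_def by blast
    have "cinner s y = cinner (f z) y" for y
    proof (rule sums_unique2)
      show "(\<lambda>n. cinner (z ^ n *\<^sub>C a n) y) sums cinner s y"
        by (rule bounded_linear.sums[OF cinner.bounded_linear_left s])
      show "(\<lambda>n. cinner (z ^ n *\<^sub>C a n) y) sums cinner (f z) y"
        using holomorphic_power_series[OF disc_analytic_cinner[OF f] z, of y]
        by (simp add: cinner_scaleC_left c mult.commute)
    qed
    then have "s = f z"
      by (intro cinner_eqI) (metis inner_commute inner_eq_Re_cinner)
    with s show ?thesis by simp
  qed
  with summable show thesis by (intro that[of a]) (simp add: has_power_series_def)
qed

text \<open>The difference quotient is itself a series of polynomials in w. It converges uniformly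
  on a disc around 0 that contains z, so it extends continuously to w = z, and the value there is
  the derivative.\<close>

lemma has_power_series_deriv:
  fixes f :: "complex \<Rightarrow> 'a::chilbert_space"
  assumes f: "has_power_series f a" and z: "z \<in> ball 0 1"
  shows "has_cderiv f (\<Sum>n. z ^ n *\<^sub>C of_nat (Suc n) *\<^sub>C a (Suc n)) z"
    and "summable (\<lambda>n. z ^ n *\<^sub>C of_nat (Suc n) *\<^sub>C a (Suc n))"
proof -
  let ?b = "\<lambda>n. of_nat (Suc n) *\<^sub>C a (Suc n)"
  obtain r where r: "cmod z < r" "r < 1" using dense[of "cmod z" 1] z by auto
  then have r0: "0 < r" using norm_ge_zero[of z] by linarith
  \<comment> \<open>This is (w^n - z^n) / (w - z), written as a polynomial so that it makes sense at
    w = z.\<close>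
  define p where "p n w = (\<Sum>i<n. z ^ (n - Suc i) * w ^ i)" for n w
  have M: "summable (\<lambda>n. real (Suc n) * norm (a (Suc n)) * r ^ n)"
    using termdiff_converges[of r 1 "\<lambda>n. norm (a n)"] f r r0
    by (auto simp: has_power_series_def diffs_def)
  have bound: "norm (p (Suc n) w *\<^sub>C a (Suc n)) \<le> real (Suc n) * norm (a (Suc n)) * r ^ n"
    if w: "w \<in> ball 0 r" for n w
  proof -
    have "cmod (p (Suc n) w) \<le> (\<Sum>i<Suc n. cmod (z ^ (Suc n - Suc i) * w ^ i))"
      unfolding p_def by (rule norm_sum)
    also have "\<dots> \<le> (\<Sum>i<Suc n. r ^ n)"
    proof (rule sum_mono)
      fix i assume i: "i \<in> {..<Suc n}"
      have "cmod (z ^ (Suc n - Suc i) * w ^ i) \<le> r ^ (n - i) * r ^ i"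
        using r w r0 by (auto simp: norm_mult norm_power intro!: mult_mono power_mono)
      also have "\<dots> = r ^ n" using i by (simp add: power_add[symmetric])
      finally show "cmod (z ^ (Suc n - Suc i) * w ^ i) \<le> r ^ n" .
    qed
    finally have "cmod (p (Suc n) w) \<le> real (Suc n) * r ^ n" by simp
    from mult_right_mono[OF this, of "norm (a (Suc n))"]
    show ?thesis by (simp add: norm_scaleC mult_ac)
  qed
  define g where "g w = (\<Sum>n. p (Suc n) w *\<^sub>C a (Suc n))" for w
  have "uniform_limit (ball 0 r) (\<lambda>n w. \<Sum>i<n. p (Suc i) w *\<^sub>C a (Suc i)) g sequentially"
    unfolding g_def by (rule Weierstrass_m_test[OF bound M])
  then have "continuous_on (ball 0 r) g"
    by (rule uniform_limit_theorem[rotated])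
      (auto intro!: always_eventually continuous_on_sum scaleC.continuous_on continuous_intros simp: p_def)
  then have "isCont g z" using r by (simp add: continuous_on_eq_continuous_at)
  then have g_lim: "(g \<longlongrightarrow> g z) (at z)" by (simp add: isCont_def)
  have pz: "p (Suc n) z = z ^ n * of_nat (Suc n)" for n
  proof -
    have "p (Suc n) z = (\<Sum>i<Suc n. z ^ n)"
      unfolding p_def by (intro sum.cong) (auto simp: power_add[symmetric])
    then show ?thesis by (simp add: mult.commute)
  qed
  then have gz: "g z = (\<Sum>n. z ^ n *\<^sub>C ?b n)" by (simp add: g_def scaleC_scaleC)
  have "g w = inverse (w - z) *\<^sub>C (f w - f z)" if w: "w \<in> ball 0 r - {z}" for w
  proof -
    have "w \<in> ball 0 1" using w r by auto
    then have "(\<lambda>n. w ^ n *\<^sub>C a n - z ^ n *\<^sub>C a n) sums (f w - f z)"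
      using f z unfolding has_power_series_def by (intro sums_diff) auto
    then have "(\<lambda>n. inverse (w - z) *\<^sub>C (w ^ n *\<^sub>C a n - z ^ n *\<^sub>C a n))
        sums (inverse (w - z) *\<^sub>C (f w - f z))"
      by (rule bounded_linear.sums[OF scaleC.bounded_linear_right])
    moreover have "inverse (w - z) *\<^sub>C (w ^ n *\<^sub>C a n - z ^ n *\<^sub>C a n) = p n w *\<^sub>C a n" for n
    proof -
      have "inverse (w - z) * (w ^ n - z ^ n) = p n w"
        using w by (simp add: power_diff_sumr2 p_def)
      then show ?thesis by (simp add: scaleC.diff_left[symmetric] scaleC_scaleC)
    qed
    ultimately have "(\<lambda>n. p n w *\<^sub>C a n) sums (inverse (w - z) *\<^sub>C (f w - f z))" by simp
    then have "(\<lambda>n. p (Suc n) w *\<^sub>C a (Suc n)) sums (inverse (w - z) *\<^sub>C (f w - f z))"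
      by (subst sums_Suc_iff) (simp add: p_def)
    then show ?thesis unfolding g_def by (rule sums_unique[symmetric])
  qed
  then have "\<forall>\<^sub>F w in at z. g w = inverse (w - z) *\<^sub>C (f w - f z)"
    using eventually_at_in_open[of "ball 0 r" z] r by (auto elim: eventually_mono)
  then show "has_cderiv f (\<Sum>n. z ^ n *\<^sub>C ?b n) z"
    unfolding has_cderiv_def gz[symmetric] by (rule Lim_transform_eventually[OF g_lim])
  have "summable (\<lambda>n. p (Suc n) z *\<^sub>C a (Suc n))"
    by (rule summable_comparison_test'[OF M, of 0]) (use bound[of z] r in simp)
  then show "summable (\<lambda>n. z ^ n *\<^sub>C ?b n)" by (simp add: pz scaleC_scaleC)
qed

lemma has_power_series_disc_analytic:
  fixes f :: "complex \<Rightarrow> 'a::chilbert_space"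
  shows "has_power_series f a \<Longrightarrow> disc_analytic f"
  unfolding disc_analytic_def using has_power_series_deriv(1) by blast

lemma has_power_series_cderiv:
  fixes f :: "complex \<Rightarrow> 'a::chilbert_space"
  assumes f: "has_power_series f a"
  shows "has_power_series (cderiv f) (\<lambda>n. of_nat (Suc n) *\<^sub>C a (Suc n))"
  unfolding has_power_series_def
proof (intro conjI allI impI ballI)
  fix z :: complex assume z: "z \<in> ball 0 1"
  have "cderiv f z = (\<Sum>n. z ^ n *\<^sub>C of_nat (Suc n) *\<^sub>C a (Suc n))"
    unfolding cderiv_def using has_power_series_deriv(1)[OF f z] has_cderiv_unique by blast
  with has_power_series_deriv(2)[OF f z]
  show "(\<lambda>n. z ^ n *\<^sub>C of_nat (Suc n) *\<^sub>C a (Suc n)) sums cderiv f z"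
    by (simp only: summable_sums)
next
  fix x :: real assume "\<bar>x\<bar> < 1"
  then show "summable (\<lambda>n. norm (of_nat (Suc n) *\<^sub>C a (Suc n)) * x ^ n)"
    using termdiff_converges[of x 1 "\<lambda>n. norm (a n)"] f
    by (auto simp: has_power_series_def diffs_def norm_scaleC simp del: of_nat_Suc)
qed

lemma has_power_series_cong:
  "(\<And>z. z \<in> ball 0 1 \<Longrightarrow> f z = g z) \<Longrightarrow> has_power_series f a \<Longrightarrow> has_power_series g a"
  by (simp add: has_power_series_def)

lemma has_power_series_scaleC:
  assumes f: "has_power_series f a"
  shows "has_power_series (\<lambda>z. c *\<^sub>C f z) (\<lambda>n. c *\<^sub>C a n)"
  unfolding has_power_series_def
proof (intro conjI allI impI ballI)
  fix x :: real assume "\<bar>x\<bar> < 1"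
  then have "summable (\<lambda>n. cmod c * (norm (a n) * x ^ n))"
    using f by (intro summable_mult) (simp add: has_power_series_def)
  then show "summable (\<lambda>n. norm (c *\<^sub>C a n) * x ^ n)" by (simp add: norm_scaleC mult.assoc)
next
  fix z :: complex assume "z \<in> ball 0 1"
  then have "(\<lambda>n. z ^ n *\<^sub>C a n) sums f z" using f by (simp add: has_power_series_def)
  from bounded_linear.sums[OF scaleC.bounded_linear_right this]
  have "(\<lambda>n. c *\<^sub>C z ^ n *\<^sub>C a n) sums (c *\<^sub>C f z)" .
  then show "(\<lambda>n. z ^ n *\<^sub>C c *\<^sub>C a n) sums (c *\<^sub>C f z)"
    by (simp add: scaleC_scaleC mult.commute)
qed

lemma has_power_series_add:
  assumes f: "has_power_series f a" and g: "has_power_series g b"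
  shows "has_power_series (\<lambda>z. f z + g z) (\<lambda>n. a n + b n)"
  unfolding has_power_series_def
proof (intro conjI allI impI ballI)
  fix x :: real assume x: "\<bar>x\<bar> < 1"
  show "summable (\<lambda>n. norm (a n + b n) * x ^ n)"
  proof (rule summable_comparison_test')
    show "summable (\<lambda>n. norm (a n) * \<bar>x\<bar> ^ n + norm (b n) * \<bar>x\<bar> ^ n)"
      using f g x by (intro summable_add) (simp_all add: has_power_series_def)
    show "norm (norm (a n + b n) * x ^ n) \<le> norm (a n) * \<bar>x\<bar> ^ n + norm (b n) * \<bar>x\<bar> ^ n" for n
      by (simp add: abs_mult power_abs distrib_right[symmetric] mult_right_mono norm_triangle_ineq)
  qed
next
  fix z :: complex assume "z \<in> ball 0 1"
  then show "(\<lambda>n. z ^ n *\<^sub>C (a n + b n)) sums (f z + g z)"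
    unfolding scaleC_add_right using f g by (intro sums_add) (simp_all add: has_power_series_def)
qed

lemma has_power_series_0:
  assumes "has_power_series f a"
  shows "f 0 = a 0"
proof (rule sums_unique2)
  show "(\<lambda>n. 0 ^ n *\<^sub>C a n) sums f 0" using assms by (simp add: has_power_series_def)
  have "(\<lambda>n. 0 ^ n *\<^sub>C a n) = (\<lambda>n. if n = 0 then a n else 0)" by (auto simp: fun_eq_iff power_0_left)
  then show "(\<lambda>n. 0 ^ n *\<^sub>C a n) sums a 0" using sums_single[of 0 a] by simp
qed

text \<open>Iterated differentiation moves the kth coefficient to position 0 with factor k!. The
  lemma also serves as uniqueness of coefficients, from which the linearity of the Taylor
  coefficients of H in u will follow.\<close>

lemma taylor_coeff_eq:
  fixes f :: "complex \<Rightarrow> 'a::chilbert_space"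
  assumes f: "has_power_series f a"
  shows "taylor_coeff f k = a k"
proof -
  have "has_power_series ((cderiv ^^ k) f) (\<lambda>n. (fact (n + k) / fact n) *\<^sub>C a (n + k))"
  proof (induction k)
    case (Suc k)
    have "of_nat (Suc n) *\<^sub>C (fact (Suc n + k) / fact (Suc n)) *\<^sub>C a (Suc n + k)
        = (fact (n + Suc k) / fact n) *\<^sub>C a (n + Suc k)" for n
      by (simp add: scaleC_scaleC field_simps del: of_nat_Suc)
    with has_power_series_cderiv[OF Suc] show ?case by simp
  qed (use f in simp)
  from has_power_series_0[OF this] show ?thesis
    by (simp add: taylor_coeff_def scaleC_scaleC)
qed

text \<open>In the mean over a circle f - f 0 is orthogonal to constants, since <f, f 0> has mean |f
  0|^2 by Cauchy's formula. It serves both Bessel's inequality and the comparison of h with its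
  value at 0.\<close>

lemma mean_value_norm:
  fixes f :: "complex \<Rightarrow> 'a::chilbert_space"
  assumes f: "disc_analytic f" and r: "0 < r" "r < 1"
  shows "integral {0..2*pi} (\<lambda>t. (norm (f (complex_of_real r * cis t)))\<^sup>2)
    = 2 * pi * (norm (f 0))\<^sup>2 + integral {0..2*pi} (\<lambda>t. (norm (f (complex_of_real r * cis t) - f 0))\<^sup>2)"
proof -
  let ?f = "\<lambda>t. f (complex_of_real r * cis t)"
  have "((\<lambda>t. cinner (?f t) (f 0)) has_integral complex_of_real (2 * pi) * cinner (f 0) (f 0)) {0..2*pi}"
    using holomorphic_fourier_coeff[OF disc_analytic_cinner[OF f, of "f 0"] r, of 0] by simp
  from has_integral_linear[OF this bounded_linear_Re]
  have 1: "((\<lambda>t. inner (?f t) (f 0)) has_integral 2 * pi * (norm (f 0))\<^sup>2) {0..2*pi}"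
    by (simp add: o_def Re_cinner cinner_self)
  have "((\<lambda>t. (norm (?f t - f 0))\<^sup>2) has_integral
      integral {0..2*pi} (\<lambda>t. (norm (?f t - f 0))\<^sup>2)) {0..2*pi}"
    using r by (intro integrable_integral integrable_continuous_real continuous_intros
        disc_analytic_circle[OF f]) auto
  from has_integral_add[OF has_integral_add[OF this has_integral_mult_right[OF 1, of 2]]
      has_integral_const_real[of "- (norm (f 0))\<^sup>2" 0 "2*pi"]]
  have "((\<lambda>t. (norm (?f t))\<^sup>2) has_integral integral {0..2*pi} (\<lambda>t. (norm (?f t - f 0))\<^sup>2)
      + 2 * (2 * pi * (norm (f 0))\<^sup>2) + (2 * pi) * (- (norm (f 0))\<^sup>2)) {0..2*pi}"
    by (simp add: power2_norm_eq_inner inner_diff_left inner_diff_right inner_commute)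
  from integral_unique[OF this] show ?thesis by simp
qed

text \<open>Each induction step splits off f 0 by orthogonality and divides the remainder f - f 0 by
  z, so no infinite sum is exchanged with an integral.\<close>

lemma power_series_bessel:
  fixes f :: "complex \<Rightarrow> 'a::chilbert_space"
  assumes f: "has_power_series f a" and r: "0 < r" "r < 1"
  shows "2 * pi * (\<Sum>n<N. r ^ (2 * n) * (norm (a n))\<^sup>2)
    \<le> integral {0..2*pi} (\<lambda>t. (norm (f (complex_of_real r * cis t)))\<^sup>2)"
  using f
proof (induction N arbitrary: f a)
  case 0
  have "0 \<le> integral {0..2*pi} (\<lambda>t. (norm (f (complex_of_real r * cis t)))\<^sup>2)"
    using r by (intro integral_nonneg integrable_continuous_real continuous_intros
        disc_analytic_circle has_power_series_disc_analytic[OF 0]) auto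
  then show ?case by simp
next
  case (Suc N)
  define g where "g z = (\<Sum>n. z ^ n *\<^sub>C a (Suc n))" for z
  have summ: "summable (\<lambda>n. norm (a (Suc n)) * x ^ n)" if "\<bar>x\<bar> < 1" for x :: real
  proof (rule summable_comparison_test')
    \<comment> \<open>The formally differentiated series dominates the shifted one, because its
      coefficients carry the extra factor n + 1.\<close>
    have "summable (\<lambda>n. diffs (\<lambda>n. norm (a n)) n * \<bar>x\<bar> ^ n)"
      using termdiff_converges[of "\<bar>x\<bar>" 1 "\<lambda>n. norm (a n)"] Suc.prems that
      by (auto simp: has_power_series_def)
    then show "summable (\<lambda>n. diffs (\<lambda>n. norm (a n)) n * \<bar>x\<bar> ^ n)" .
    show "norm (norm (a (Suc n)) * x ^ n) \<le> diffs (\<lambda>n. norm (a n)) n * \<bar>x\<bar> ^ n" if "n \<ge> 0" for n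
      by (auto simp: diffs_def abs_mult power_abs algebra_simps)
  qed
  have g_sums: "(\<lambda>n. z ^ n *\<^sub>C a (Suc n)) sums g z" if z: "z \<in> ball 0 1" for z
    unfolding g_def
    by (rule summable_sums, rule summable_norm_cancel)
      (use summ[of "cmod z"] z in \<open>simp add: norm_scaleC norm_power mult.commute\<close>)
  then have g: "has_power_series g (\<lambda>n. a (Suc n))"
    using summ by (simp add: has_power_series_def)
  have fg: "f z - f 0 = z *\<^sub>C g z" if z: "z \<in> ball 0 1" for z
  proof (rule sums_unique2)
    have "(\<lambda>n. z *\<^sub>C z ^ n *\<^sub>C a (Suc n)) sums (z *\<^sub>C g z)"
      by (rule bounded_linear.sums[OF scaleC.bounded_linear_right g_sums[OF z]])
    then show "(\<lambda>n. z ^ Suc n *\<^sub>C a (Suc n)) sums (z *\<^sub>C g z)" by (simp add: scaleC_scaleC)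
    show "(\<lambda>n. z ^ Suc n *\<^sub>C a (Suc n)) sums (f z - f 0)"
      using Suc.prems z has_power_series_0[OF Suc.prems]
      by (subst sums_Suc_iff) (simp add: has_power_series_def)
  qed
  have "2 * pi * (\<Sum>n<Suc N. r ^ (2 * n) * (norm (a n))\<^sup>2)
      = 2 * pi * (norm (f 0))\<^sup>2 + r\<^sup>2 * (2 * pi * (\<Sum>n<N. r ^ (2 * n) * (norm (a (Suc n)))\<^sup>2))"
    unfolding sum.lessThan_Suc_shift has_power_series_0[OF Suc.prems]
    by (simp add: sum_distrib_left power2_eq_square algebra_simps)
  also have "\<dots> \<le> 2 * pi * (norm (f 0))\<^sup>2
      + r\<^sup>2 * integral {0..2*pi} (\<lambda>t. (norm (g (complex_of_real r * cis t)))\<^sup>2)"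
    using Suc.IH[OF g] by (intro add_left_mono mult_left_mono) auto
  also have "r\<^sup>2 * integral {0..2*pi} (\<lambda>t. (norm (g (complex_of_real r * cis t)))\<^sup>2)
      = integral {0..2*pi} (\<lambda>t. (norm (f (complex_of_real r * cis t) - f 0))\<^sup>2)"
    using r by (simp add: fg norm_scaleC norm_mult power_mult_distrib)
  also have "2 * pi * (norm (f 0))\<^sup>2 + \<dots>
      = integral {0..2*pi} (\<lambda>t. (norm (f (complex_of_real r * cis t)))\<^sup>2)"
    by (rule mean_value_norm[OF has_power_series_disc_analytic[OF Suc.prems] r, symmetric])
  finally show ?case .
qed

section \<open>Square summable sequences\<close>

lemma summable_on_nat_iff:
  fixes f :: "nat \<Rightarrow> real"
  assumes "\<And>n. f n \<ge> 0"
  shows "f summable_on UNIV \<longleftrightarrow> summable f"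
  using assms summable_nonneg_imp_summable_on[of f] summable_on_UNIV_nonneg_real_iff[of f] by blast

lemma summable_ell2: "summable (\<lambda>n. (norm (Rep_ell2 x n))\<^sup>2)"
  using Rep_ell2[of x] by (simp add: summable_on_nat_iff)

lemma norm_ell2_sq_suminf: "(norm x)\<^sup>2 = (\<Sum>n. (norm (Rep_ell2 x n))\<^sup>2)"
  unfolding norm_ell2_sq
  by (rule infsumI) (simp add: sums_nonneg_imp_has_sum summable_sums[OF summable_ell2])

lemma Rep_Abs_ell2: "summable (\<lambda>n. (norm (x n))\<^sup>2) \<Longrightarrow> Rep_ell2 (Abs_ell2 x) = x"
  by (rule Abs_ell2_inverse) (simp add: summable_on_nat_iff)

lift_definition ell2_shift :: "(nat, 'a::complex_inner) ell2 \<Rightarrow> (nat, 'a) ell2"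
  is "\<lambda>x n. x (Suc n)"
  subgoal for x
    using summable_Suc_iff[of "\<lambda>n. (norm (x n))\<^sup>2"] by (simp add: summable_on_nat_iff)
  done

lemma ell2_shift_isometric: "(norm (Rep_ell2 x 0))\<^sup>2 + (norm (ell2_shift x))\<^sup>2 = (norm x)\<^sup>2"
  using suminf_split_head[OF summable_ell2[of x]]
  by (simp add: norm_ell2_sq_suminf ell2_shift.rep_eq)

lemma norm_ell2_shift_le: "norm (ell2_shift x) \<le> norm x"
proof (rule power2_le_imp_le)
  show "(norm (ell2_shift x))\<^sup>2 \<le> (norm x)\<^sup>2"
    using ell2_shift_isometric[of x] zero_le_power2[of "norm (Rep_ell2 x 0)"] by linarith
qed simp

lemma bounded_clinear_ell2_shift: "bounded_clinear ell2_shift"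
proof (rule bounded_clinearI[of _ 1])
  show "ell2_shift (x + y) = ell2_shift x + ell2_shift y" for x y :: "(nat, 'a) ell2"
    by transfer simp
  show "ell2_shift (c *\<^sub>C x) = c *\<^sub>C ell2_shift x" for c and x :: "(nat, 'a) ell2"
    by transfer simp
qed (simp add: norm_ell2_shift_le)

lemma bounded_clinear_Rep_ell2: "bounded_clinear (\<lambda>x. Rep_ell2 x i)"
  by (rule bounded_clinearI[of _ 1]) (simp_all add: plus_ell2.rep_eq scaleC_ell2.rep_eq norm_Rep_ell2_le)

lemma contraction_ell2_shift: "contraction ell2_shift"
  by (simp add: contraction_iff bounded_clinear_ell2_shift norm_ell2_shift_le)

text \<open>Writing x = y - z (shift y) makes the partial sums telescope to y(0) - z^N y(N).
  Evaluation at 0 after the resolvent of the shift is thus the generating function of a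
  sequence.\<close>

lemma resolvent_ell2_shift_sums:
  fixes x :: "(nat, 'a::chilbert_space) ell2"
  assumes z: "z \<in> ball 0 1"
  shows "(\<lambda>n. z ^ n *\<^sub>C Rep_ell2 x n) sums Rep_ell2 (resolvent ell2_shift z x) 0"
proof -
  define y where "y = resolvent ell2_shift z x"
  have "x = y - z *\<^sub>C ell2_shift y"
    unfolding y_def by (rule resolvent_eq[OF contraction_ell2_shift z, symmetric])
  then have x: "Rep_ell2 x n = Rep_ell2 y n - z *\<^sub>C Rep_ell2 y (Suc n)" for n
    by (simp add: minus_ell2.rep_eq scaleC_ell2.rep_eq ell2_shift.rep_eq)
  have partial: "(\<Sum>n<N. z ^ n *\<^sub>C Rep_ell2 x n) = Rep_ell2 y 0 - z ^ N *\<^sub>C Rep_ell2 y N" for N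
    by (induction N) (simp_all add: x scaleC.diff_right scaleC_scaleC mult.commute)
  have "(\<lambda>N. z ^ N *\<^sub>C Rep_ell2 y N) \<longlonglongrightarrow> 0"
  proof (rule Lim_null_comparison)
    show "\<forall>\<^sub>F N in sequentially. norm (z ^ N *\<^sub>C Rep_ell2 y N) \<le> cmod z ^ N * norm y"
      by (rule always_eventually)
        (auto simp: norm_scaleC norm_power norm_Rep_ell2_le intro!: mult_left_mono)
    have "(\<lambda>N. cmod z ^ N * norm y) \<longlonglongrightarrow> 0 * norm y"
      using z by (intro tendsto_mult LIMSEQ_realpow_zero tendsto_const) auto
    then show "(\<lambda>N. cmod z ^ N * norm y) \<longlonglongrightarrow> 0" by simp
  qed
  then have "(\<lambda>N. Rep_ell2 y 0 - z ^ N *\<^sub>C Rep_ell2 y N) \<longlonglongrightarrow> Rep_ell2 y 0 - 0"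
    by (intro tendsto_diff tendsto_const)
  then show ?thesis by (simp add: sums_def partial y_def)
qed

section \<open>Complementary sequences\<close>

lemma bilateral_ell2:
  fixes x :: "int \<Rightarrow> 'a::complex_inner"
  assumes neg: "summable (\<lambda>n. (norm (x (- int n - 1)))\<^sup>2)"
    and pos: "summable (\<lambda>n. (norm (x (int n)))\<^sup>2)"
  shows "Rep_ell2 (Abs_ell2 x) = x"
    and "(norm (Abs_ell2 x))\<^sup>2 = (\<Sum>n. (norm (x (- int n - 1)))\<^sup>2) + (\<Sum>n. (norm (x (int n)))\<^sup>2)"
proof -
  let ?g = "\<lambda>k. (norm (x k))\<^sup>2"
  have "((?g \<circ> (\<lambda>n. - int n - 1)) has_sum (\<Sum>n. (norm (x (- int n - 1)))\<^sup>2)) UNIV"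
    using sums_nonneg_imp_has_sum[OF summable_sums[OF neg]] by (simp add: o_def)
  then have 1: "(?g has_sum (\<Sum>n. (norm (x (- int n - 1)))\<^sup>2)) (range (\<lambda>n. - int n - 1))"
    by (subst has_sum_reindex) (auto simp: inj_on_def)
  have "((?g \<circ> int) has_sum (\<Sum>n. (norm (x (int n)))\<^sup>2)) UNIV"
    using sums_nonneg_imp_has_sum[OF summable_sums[OF pos]] by (simp add: o_def)
  then have 2: "(?g has_sum (\<Sum>n. (norm (x (int n)))\<^sup>2)) (range int)"
    by (subst has_sum_reindex) (auto simp: inj_on_def)
  have "k \<in> range (\<lambda>n. - int n - 1) \<union> range int" for k
  proof (cases "k \<ge> 0")
    case True
    then show ?thesis using rangeI[of int "nat k"] by simp
  next
    case False
    then show ?thesis using rangeI[of "\<lambda>n. - int n - 1" "nat (- k - 1)"] by simp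
  qed
  then have "range (\<lambda>n. - int n - 1) \<union> range int = UNIV" by blast
  moreover have "range (\<lambda>n. - int n - 1) \<inter> range int = {}" by auto
  ultimately have sum: "(?g has_sum
      (\<Sum>n. (norm (x (- int n - 1)))\<^sup>2) + (\<Sum>n. (norm (x (int n)))\<^sup>2)) UNIV"
    using has_sum_Un_disjoint[OF 1 2] by simp
  then show *: "Rep_ell2 (Abs_ell2 x) = x"
    by (intro Abs_ell2_inverse) (auto simp: summable_on_def)
  show "(norm (Abs_ell2 x))\<^sup>2 = (\<Sum>n. (norm (x (- int n - 1)))\<^sup>2) + (\<Sum>n. (norm (x (int n)))\<^sup>2)"
    unfolding norm_ell2_sq * by (rule infsumI[OF sum])
qed

text \<open>The squared norm of the bilateral sequence is |A u|^2 plus the sum of the |H_n u|^2, and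
  |u|^2 - |A u|^2 = |D_A u|^2. Linearity of the bilateral map can be read off entrywise only once
  square summability makes \<open>Abs_ell2\<close> faithful.\<close>

lemma one_complementary_iff:
  fixes F :: "int \<Rightarrow> 'u::chilbert_space \<Rightarrow> 'y::chilbert_space"
  assumes F: "\<And>n::nat. n \<ge> 1 \<Longrightarrow> bounded_clinear (F (- int n))"
    and summable_F: "\<And>u. summable (\<lambda>n. (norm (F (- int (Suc n)) u))\<^sup>2)"
    and A: "contraction (truncated_hankel F)"
  shows "one_complementary F H \<longleftrightarrow> (\<forall>n. bounded_clinear (H n)) \<and>
    (\<forall>u. summable (\<lambda>n. (norm (H n u))\<^sup>2)
      \<and> (\<Sum>n. (norm (H n u))\<^sup>2) \<le> (norm (defect_op (truncated_hankel F) u))\<^sup>2)"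
proof -
  define x where "x u k = (if k < 0 then F k u else H (nat k) u)" for u and k :: int
  have sF: "summable (\<lambda>n. (norm (x u (- int n - 1)))\<^sup>2)" for u
  proof -
    have "- int (Suc n) = - int n - 1" for n by simp
    then show ?thesis using summable_F[of u] by (simp only: x_def) simp
  qed
  have normA: "(\<Sum>n. (norm (x u (- int n - 1)))\<^sup>2) = (norm (truncated_hankel F u))\<^sup>2" for u
    using sF[of u]
    by (simp add: x_def truncated_hankel_def norm_ell2_sq_suminf Rep_Abs_ell2)
  have lin_F: "bounded_clinear (F k)" if "k < 0" for k
    using F[of "nat (- k)"] that by simp
  show ?thesis
  proof (cases "(\<forall>n. bounded_clinear (H n)) \<and> (\<forall>u. summable (\<lambda>n. (norm (H n u))\<^sup>2))")
    case True
    then have lin_H: "\<And>n. bounded_clinear (H n)" and sH: "\<And>u. summable (\<lambda>n. (norm (x u (int n)))\<^sup>2)"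
      by (auto simp: x_def)
    note R = bilateral_ell2(1)[OF sF sH]
    have norm_x: "(norm (Abs_ell2 (x u)))\<^sup>2 = (norm (truncated_hankel F u))\<^sup>2 + (\<Sum>n. (norm (H n u))\<^sup>2)" for u
    proof -
      have "(\<Sum>n. (norm (x u (int n)))\<^sup>2) = (\<Sum>n. (norm (H n u))\<^sup>2)" by (simp add: x_def)
      then show ?thesis using bilateral_ell2(2)[OF sF sH, of u] by (simp only: normA)
    qed
    have add: "Abs_ell2 (x (u + v)) = Abs_ell2 (x u) + Abs_ell2 (x v)" for u v
      by (simp add: Rep_ell2_inject[symmetric] plus_ell2.rep_eq R)
        (simp add: fun_eq_iff x_def bounded_clinear_add lin_H lin_F)
    have scale: "Abs_ell2 (x (c *\<^sub>C u)) = c *\<^sub>C Abs_ell2 (x u)" for c u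
      by (simp add: Rep_ell2_inject[symmetric] scaleC_ell2.rep_eq R)
        (simp add: fun_eq_iff x_def bounded_clinear_scaleC lin_H lin_F)
    have "contraction (\<lambda>u. Abs_ell2 (x u)) \<longleftrightarrow> (\<forall>u. norm (Abs_ell2 (x u)) \<le> norm u)"
      unfolding contraction_iff using bounded_clinearI[of "\<lambda>u. Abs_ell2 (x u)" 1] add scale by auto
    also have "\<dots> \<longleftrightarrow> (\<forall>u. (norm (Abs_ell2 (x u)))\<^sup>2 \<le> (norm u)\<^sup>2)"
      by simp
    also have "\<dots> \<longleftrightarrow> (\<forall>u. (\<Sum>n. (norm (H n u))\<^sup>2) \<le> (norm (defect_op (truncated_hankel F) u))\<^sup>2)"
      unfolding norm_x norm_defect_op[OF A] by (simp add: le_diff_eq add.commute)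
    finally show ?thesis
      using True by (simp add: one_complementary_def x_def[abs_def])
  qed (auto simp: one_complementary_def)
qed

section \<open>Schur functions\<close>

lemma
  assumes "bounded_clinear_on S R T" "x \<in> S"
  shows bounded_clinear_on_add: "y \<in> S \<Longrightarrow> T (x + y) = T x + T y"
    and bounded_clinear_on_scaleC: "T (c *\<^sub>C x) = c *\<^sub>C T x"
    and bounded_clinear_on_in: "T x \<in> R"
  using assms by (auto simp: bounded_clinear_on_def)

lemma bounded_clinear_on_diff:
  assumes T: "bounded_clinear_on S R T" and S: "\<And>c x. x \<in> S \<Longrightarrow> c *\<^sub>C x \<in> S"
    and "x \<in> S" "y \<in> S"
  shows "T (x - y) = T x - T y"
proof -
  have neg: "(- 1) *\<^sub>C v = - v" for v :: "'c::complex_inner"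
    by (simp add: scaleC.minus_left)
  have "T (x + (- 1) *\<^sub>C y) = T x + (- 1) *\<^sub>C T y"
    using bounded_clinear_on_add[OF T \<open>x \<in> S\<close> S[OF \<open>y \<in> S\<close>]]
      bounded_clinear_on_scaleC[OF T \<open>y \<in> S\<close>] by simp
  then show ?thesis by (simp add: neg)
qed

lemma has_cderiv_times:
  assumes "has_cderiv g D z"
  shows "has_cderiv (\<lambda>w. w *\<^sub>C g w) (g z + z *\<^sub>C D) z"
proof -
  have "((\<lambda>w. g w + z *\<^sub>C (inverse (w - z) *\<^sub>C (g w - g z))) \<longlongrightarrow> g z + z *\<^sub>C D) (at z)"
    using assms has_cderiv_imp_isCont[OF assms] unfolding has_cderiv_def isCont_def
    by (intro tendsto_add scaleC.tendsto tendsto_const)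
  moreover have "\<forall>\<^sub>F w in at z. g w + z *\<^sub>C (inverse (w - z) *\<^sub>C (g w - g z))
      = inverse (w - z) *\<^sub>C (w *\<^sub>C g w - z *\<^sub>C g z)"
    unfolding eventually_at_filter
  proof (intro always_eventually allI impI)
    fix w assume "w \<noteq> z"
    then have "g w = inverse (w - z) *\<^sub>C (w - z) *\<^sub>C g w" by (simp add: scaleC_scaleC)
    also have "\<dots> = inverse (w - z) *\<^sub>C (w *\<^sub>C g w - z *\<^sub>C g w)" by (simp add: scaleC.diff_left)
    finally have "g w + z *\<^sub>C (inverse (w - z) *\<^sub>C (g w - g z))
        = inverse (w - z) *\<^sub>C (w *\<^sub>C g w - z *\<^sub>C g w) + inverse (w - z) *\<^sub>C z *\<^sub>C (g w - g z)"
      by (metis scaleC_scaleC mult.commute)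
    also have "\<dots> = inverse (w - z) *\<^sub>C (w *\<^sub>C g w - z *\<^sub>C g z)"
      by (simp add: scaleC_add_right[symmetric] scaleC.diff_right)
    finally show "g w + z *\<^sub>C (inverse (w - z) *\<^sub>C (g w - g z))
        = inverse (w - z) *\<^sub>C (w *\<^sub>C g w - z *\<^sub>C g z)" .
  qed
  ultimately show ?thesis unfolding has_cderiv_def by (rule Lim_transform_eventually)
qed

locale schur_function =
  fixes V :: "complex \<Rightarrow> 'u::chilbert_space \<Rightarrow> 'y::chilbert_space \<times> 'u" and S :: "'u set"
  assumes V: "V \<in> schur_class S (UNIV \<times> S)"
    and S: "closed S" "0 \<in> S" "\<And>x y. x \<in> S \<Longrightarrow> y \<in> S \<Longrightarrow> x + y \<in> S"
      "\<And>c x. x \<in> S \<Longrightarrow> c *\<^sub>C x \<in> S"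
begin

lemma S_diff: "x \<in> S \<Longrightarrow> y \<in> S \<Longrightarrow> x - y \<in> S"
  using S(3)[OF _ S(4)[of y "- 1"], of x] by (simp add: scaleC.minus_left)

lemma V_linear: "z \<in> ball 0 1 \<Longrightarrow> bounded_clinear_on S (UNIV \<times> S) (V z)"
  using V by (simp add: schur_class_def contraction_on_def)

lemma V_diff: "\<lbrakk>z \<in> ball 0 1; x \<in> S; y \<in> S\<rbrakk> \<Longrightarrow> V z (x - y) = V z x - V z y"
  by (rule bounded_clinear_on_diff[OF V_linear S(4)])

lemma V_scaleC: "\<lbrakk>z \<in> ball 0 1; x \<in> S\<rbrakk> \<Longrightarrow> V z (c *\<^sub>C x) = c *\<^sub>C V z x"
  by (rule bounded_clinear_on_scaleC[OF V_linear])

lemma snd_V_in: "\<lbrakk>z \<in> ball 0 1; x \<in> S\<rbrakk> \<Longrightarrow> snd (V z x) \<in> S"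
  using bounded_clinear_on_in[OF V_linear] by fastforce

lemma norm_V:
  assumes "z \<in> ball 0 1" "x \<in> S"
  shows "norm (V z x) \<le> norm x"
proof -
  have "norm (V z x) \<le> onorm_on S (V z) * norm x" by (rule onorm_on_upper[OF V_linear assms(2)]) fact
  also have "\<dots> \<le> 1 * norm x"
    using V assms(1) by (intro mult_right_mono) (auto simp: schur_class_def contraction_on_def)
  finally show ?thesis by simp
qed

definition N :: "complex \<Rightarrow> 'u \<Rightarrow> 'u" where "N z x = x - z *\<^sub>C snd (V z x)"

lemma N_diff: "\<lbrakk>z \<in> ball 0 1; x \<in> S; y \<in> S\<rbrakk> \<Longrightarrow> N z (x - y) = N z x - N z y"
  by (simp add: N_def V_diff scaleC.diff_right)

lemma N_scaleC: "\<lbrakk>z \<in> ball 0 1; x \<in> S\<rbrakk> \<Longrightarrow> N z (c *\<^sub>C x) = c *\<^sub>C N z x"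
  by (simp add: N_def V_scaleC scaleC.diff_right scaleC_prod_def scaleC_scaleC mult.commute)

lemma bij_betw_N: "z \<in> ball 0 1 \<Longrightarrow> bij_betw (N z) S S"
  unfolding N_def[abs_def]
  by (rule bij_betw_resolvent[OF S, where R = UNIV]) (use V in \<open>simp_all add: schur_class_def\<close>)

text \<open>A bound for the inverse of \<open>N z\<close> that is locally uniform in z; it controls
  difference quotients of the inverse below.\<close>

lemma norm_le_N:
  assumes "z \<in> ball 0 1" "x \<in> S"
  shows "norm x \<le> norm (N z x) / (1 - cmod z)"
proof -
  have "norm (snd (V z x)) \<le> norm x"
    using norm_V[OF assms] norm_snd_le[of "snd (V z x)" "fst (V z x)"] by simp
  then have "norm (z *\<^sub>C snd (V z x)) \<le> cmod z * norm x"
    by (simp add: norm_scaleC mult_left_mono)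
  then have "norm x \<le> norm (N z x) + cmod z * norm x"
    using norm_triangle_sub[of x "z *\<^sub>C snd (V z x)"] by (simp add: N_def)
  then show ?thesis using assms(1) by (simp add: field_simps)
qed

text \<open>Operator norm analyticity implies pointwise analyticity. The second component of the
  derivative is kept in \<open>S\<close> so that the equation for the derivative of h can be solved
  there.\<close>

lemma V_has_cderiv:
  assumes z: "z \<in> ball 0 1" and y: "y \<in> S"
  obtains D where "snd D \<in> S" "has_cderiv (\<lambda>w. V w y) D z"
proof -
  obtain L where L: "bounded_clinear_on S (UNIV \<times> S) L"
    and lim: "((\<lambda>w. onorm_on S (\<lambda>x. inverse (w - z) *\<^sub>C (V w x - V z x) - L x)) \<longlongrightarrow> 0) (at z)"
    using V z unfolding schur_class_def by blast
  obtain C where C: "\<And>x. x \<in> S \<Longrightarrow> norm (L x) \<le> C * norm x"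
    using L unfolding bounded_clinear_on_def by blast
  have "norm (inverse (w - z) *\<^sub>C (V w y - V z y) - L y)
      \<le> onorm_on S (\<lambda>x. inverse (w - z) *\<^sub>C (V w x - V z x) - L x) * norm y"
    if w: "w \<in> ball 0 1" for w
  proof (rule onorm_on_upper[OF _ y])
    let ?T = "\<lambda>x. inverse (w - z) *\<^sub>C (V w x - V z x) - L x"
    have Vw: "bounded_clinear_on S (UNIV \<times> S) (V w)" and Vz: "bounded_clinear_on S (UNIV \<times> S) (V z)"
      using V_linear w z by blast+
    \<comment> \<open>Boundedness has to be established first: the supremum defining
      \<open>onorm_on\<close> dominates the quotients only if they are bounded above.\<close>
    show "bounded_clinear_on S UNIV ?T"
      unfolding bounded_clinear_on_def
    proof (intro conjI ballI allI)
      show "?T (a + b) = ?T a + ?T b" if "a \<in> S" "b \<in> S" for a b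
        using that by (simp add: bounded_clinear_on_add[OF Vw] bounded_clinear_on_add[OF Vz]
            bounded_clinear_on_add[OF L] scaleC_add_right scaleC.diff_right)
      show "?T (c *\<^sub>C a) = c *\<^sub>C ?T a" if "a \<in> S" for c a
        using that by (simp add: bounded_clinear_on_scaleC[OF Vw] bounded_clinear_on_scaleC[OF Vz]
            bounded_clinear_on_scaleC[OF L] scaleC.diff_right scaleC_scaleC mult.commute)
      show "\<exists>K. \<forall>x\<in>S. norm (?T x) \<le> K * norm x"
      proof (intro exI ballI)
        fix x assume x: "x \<in> S"
        have "norm (?T x) \<le> cmod (inverse (w - z)) * norm (V w x - V z x) + norm (L x)"
          using norm_triangle_ineq4[of "inverse (w - z) *\<^sub>C (V w x - V z x)" "L x"]
          by (simp add: norm_scaleC)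
        also have "\<dots> \<le> cmod (inverse (w - z)) * (2 * norm x) + C * norm x"
          using norm_triangle_ineq4[of "V w x" "V z x"] norm_V[OF w x] norm_V[OF z x]
          by (intro add_mono mult_left_mono C[OF x]) auto
        finally show "norm (?T x) \<le> (cmod (inverse (w - z)) * 2 + C) * norm x"
          by (simp add: algebra_simps)
      qed
    qed simp
  qed
  then have "\<forall>\<^sub>F w in at z. norm (inverse (w - z) *\<^sub>C (V w y - V z y) - L y)
      \<le> onorm_on S (\<lambda>x. inverse (w - z) *\<^sub>C (V w x - V z x) - L x) * norm y"
    using eventually_at_in_open[OF open_ball z] by (auto elim: eventually_mono)
  moreover have "((\<lambda>w. onorm_on S (\<lambda>x. inverse (w - z) *\<^sub>C (V w x - V z x) - L x) * norm y) \<longlongrightarrow> 0) (at z)"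
    using tendsto_mult[OF lim tendsto_const[of "norm y"]] by simp
  ultimately have "((\<lambda>w. inverse (w - z) *\<^sub>C (V w y - V z y) - L y) \<longlongrightarrow> 0) (at z)"
    by (rule Lim_null_comparison)
  then have "has_cderiv (\<lambda>w. V w y) (L y) z"
    unfolding has_cderiv_def by (rule LIM_zero_cancel)
  moreover have "snd (L y) \<in> S" using bounded_clinear_on_in[OF L y] by auto
  ultimately show thesis by (rule that[rotated])
qed

lemma times_snd_V_has_cderiv:
  assumes z: "z \<in> ball 0 1" and y: "y \<in> S"
  obtains D where "D \<in> S" "has_cderiv (\<lambda>w. w *\<^sub>C snd (V w y)) D z"
proof -
  obtain D where D: "snd D \<in> S" "has_cderiv (\<lambda>w. V w y) D z" using V_has_cderiv[OF z y] .
  have "has_cderiv (\<lambda>w. snd (V w y)) (snd D) z"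
    using tendsto_snd[OF D(2)[unfolded has_cderiv_def]]
    by (simp add: has_cderiv_def scaleC_prod_def)
  from has_cderiv_times[OF this] show thesis
    by (rule that[rotated]) (intro S D(1) snd_V_in z y)
qed

context
  fixes x assumes x: "x \<in> S"
begin

definition h :: "complex \<Rightarrow> 'u" where "h z = inv_into S (N z) x"

lemma h_in: "z \<in> ball 0 1 \<Longrightarrow> h z \<in> S"
  using bij_betw_N[of z] x unfolding h_def bij_betw_def by (metis inv_into_into)

lemma N_h: "z \<in> ball 0 1 \<Longrightarrow> N z (h z) = x"
  using bij_betw_N[of z] x unfolding h_def bij_betw_def by (metis f_inv_into_f)

text \<open>Differentiating \<open>N z (h z) = x\<close> formally gives N(z) h'(z) = q, where q is
  the derivative of w V2(w) h(z) at w = z and V2 is the second component of V. The solution d of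
  this equation is the candidate, and applying N(w) to the error of the difference quotient shows
  that the error tends to 0.\<close>

lemma h_disc_analytic: "disc_analytic h"
  unfolding disc_analytic_def
proof
  fix z :: complex assume z: "z \<in> ball 0 1"
  obtain q where q: "q \<in> S" "has_cderiv (\<lambda>w. w *\<^sub>C snd (V w (h z))) q z"
    using times_snd_V_has_cderiv[OF z h_in[OF z]] .
  have "q \<in> N z ` S" using bij_betw_N[OF z] q(1) by (simp add: bij_betw_def)
  then obtain d where d: "d \<in> S" "N z d = q" by blast
  obtain d' where d': "has_cderiv (\<lambda>w. w *\<^sub>C snd (V w d)) d' z"
    using times_snd_V_has_cderiv[OF z d(1)] by blast
  \<comment> \<open>This is N(w) applied to the error: the first summand tends to 0 by the
    definition of q, the second by continuity.\<close>
  define \<epsilon> where "\<epsilon> w = (inverse (w - z) *\<^sub>C (w *\<^sub>C snd (V w (h z)) - z *\<^sub>C snd (V z (h z))) - q)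
      + (w *\<^sub>C snd (V w d) - z *\<^sub>C snd (V z d))" for w
  have "norm (inverse (w - z) *\<^sub>C (h w - h z) - d) \<le> norm (\<epsilon> w) / (1 - cmod w)"
    if w: "w \<in> ball 0 1" for w
  proof -
    note in_S = h_in[OF w] h_in[OF z] d(1) S_diff S(4)
    have "N w (inverse (w - z) *\<^sub>C (h w - h z) - d) = inverse (w - z) *\<^sub>C (x - N w (h z)) - N w d"
      using in_S by (simp add: N_diff[OF w] N_scaleC[OF w] N_h[OF w])
    also have "x - N w (h z) = w *\<^sub>C snd (V w (h z)) - z *\<^sub>C snd (V z (h z))"
      using N_h[OF z] by (simp add: N_def algebra_simps)
    also have "N w d = q - (w *\<^sub>C snd (V w d) - z *\<^sub>C snd (V z d))"
      using d(2) by (simp add: N_def algebra_simps)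
    finally have "N w (inverse (w - z) *\<^sub>C (h w - h z) - d) = \<epsilon> w" by (simp add: \<epsilon>_def)
    moreover have "inverse (w - z) *\<^sub>C (h w - h z) - d \<in> S" using in_S by blast
    ultimately show ?thesis using norm_le_N[OF w] by metis
  qed
  then have "\<forall>\<^sub>F w in at z. norm (inverse (w - z) *\<^sub>C (h w - h z) - d) \<le> norm (\<epsilon> w) / (1 - cmod w)"
    using eventually_at_in_open[OF open_ball z] by (auto elim: eventually_mono)
  moreover have "((\<lambda>w. norm (\<epsilon> w) / (1 - cmod w)) \<longlongrightarrow>
      norm ((q - q) + (z *\<^sub>C snd (V z d) - z *\<^sub>C snd (V z d))) / (1 - cmod z)) (at z)"
    unfolding \<epsilon>_def
    using q(2)[unfolded has_cderiv_def] has_cderiv_imp_isCont[OF d'] z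
    by (intro tendsto_intros) (auto simp: isCont_def)
  then have "((\<lambda>w. norm (\<epsilon> w) / (1 - cmod w)) \<longlongrightarrow> 0) (at z)" by simp
  ultimately have "((\<lambda>w. inverse (w - z) *\<^sub>C (h w - h z) - d) \<longlongrightarrow> 0) (at z)"
    by (rule Lim_null_comparison)
  then have "has_cderiv h d z" unfolding has_cderiv_def by (rule LIM_zero_cancel)
  then show "\<exists>D. has_cderiv h D z" by blast
qed

text \<open>
  With \<open>V z (h z) = (f z, g z)\<close> and \<open>h z = x + z g z\<close>, contractivity on a circle of radius \<open>r < 1\<close> bounds
  \<open>(norm (f z))\<^sup>2\<close> by \<open>(norm (h z))\<^sup>2 - (norm (h z - x))\<^sup>2\<close>, whose mean is \<open>(norm x)\<^sup>2\<close>.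
\<close>

lemma transfer_function_bound:
  assumes f: "\<And>z. z \<in> ball 0 1 \<Longrightarrow> f z = fst (V z (h z))" and a: "has_power_series f a"
  shows "(\<Sum>n<m. (norm (a n))\<^sup>2) \<le> (norm x)\<^sup>2"
proof -
  have h0: "h 0 = x" using N_h[of 0] by (simp add: N_def)
  have le: "(\<Sum>n<m. r ^ (2 * n) * (norm (a n))\<^sup>2) \<le> (norm x)\<^sup>2" if r: "0 < r" "r < 1" for r
  proof -
    let ?c = "\<lambda>t. complex_of_real r * cis t"
    have int: "(\<lambda>t. (norm (f (?c t)))\<^sup>2) integrable_on {0..2*pi}"
      "(\<lambda>t. (norm (h (?c t)))\<^sup>2) integrable_on {0..2*pi}"
      "(\<lambda>t. (norm (h (?c t) - x))\<^sup>2) integrable_on {0..2*pi}"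
      using r
      by (auto intro!: integrable_continuous_real continuous_intros disc_analytic_circle
          h_disc_analytic has_power_series_disc_analytic[OF a])
    have pointwise: "(norm (f (?c t)))\<^sup>2 \<le> (norm (h (?c t)))\<^sup>2 - (norm (h (?c t) - x))\<^sup>2" for t
    proof -
      have z: "?c t \<in> ball 0 1" using r by (simp add: norm_mult)
      define g where "g = snd (V (?c t) (h (?c t)))"
      have "(norm (f (?c t)))\<^sup>2 + (norm g)\<^sup>2 = (norm (V (?c t) (h (?c t))))\<^sup>2"
        unfolding f[OF z] g_def by (simp add: norm_prod_def)
      also have "\<dots> \<le> (norm (h (?c t)))\<^sup>2"
        by (intro power_mono norm_V z h_in norm_ge_zero)
      finally have 1: "(norm (f (?c t)))\<^sup>2 + (norm g)\<^sup>2 \<le> (norm (h (?c t)))\<^sup>2" .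
      have "h (?c t) - x = ?c t *\<^sub>C g"
        using N_h[OF z] by (simp add: N_def g_def algebra_simps)
      then have "norm (h (?c t) - x) \<le> norm g"
        using r by (simp add: norm_scaleC norm_mult mult_left_le_one_le)
      then have "(norm (h (?c t) - x))\<^sup>2 \<le> (norm g)\<^sup>2" by (intro power_mono norm_ge_zero)
      with 1 show ?thesis by linarith
    qed
    have "2 * pi * (\<Sum>n<m. r ^ (2 * n) * (norm (a n))\<^sup>2) \<le> integral {0..2*pi} (\<lambda>t. (norm (f (?c t)))\<^sup>2)"
      by (rule power_series_bessel[OF a r])
    also have "\<dots> \<le> integral {0..2*pi} (\<lambda>t. (norm (h (?c t)))\<^sup>2 - (norm (h (?c t) - x))\<^sup>2)"
      by (intro integral_le int integrable_diff pointwise)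
    also have "\<dots> = 2 * pi * (norm x)\<^sup>2"
      using mean_value_norm[OF h_disc_analytic r] by (simp add: integral_diff int h0)
    finally show ?thesis by simp
  qed
  \<comment> \<open>The bound is uniform in r and the sum is finite, so r may tend to 1
    termwise.\<close>
  show ?thesis
  proof (rule tendsto_upperbound)
    have "((\<lambda>r. \<Sum>n<m. r ^ (2 * n) * (norm (a n))\<^sup>2) \<longlongrightarrow> (\<Sum>n<m. 1 ^ (2 * n) * (norm (a n))\<^sup>2)) (at_left 1)"
      by (intro tendsto_intros)
    then show "((\<lambda>r. \<Sum>n<m. r ^ (2 * n) * (norm (a n))\<^sup>2) \<longlongrightarrow> (\<Sum>n<m. (norm (a n))\<^sup>2)) (at_left (1::real))"
      by simp
    show "\<forall>\<^sub>F r in at_left 1. (\<Sum>n<m. r ^ (2 * n) * (norm (a n))\<^sup>2) \<le> (norm x)\<^sup>2"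
      using eventually_at_left_field[of _ "1::real"] le
      by (auto simp: eventually_at_left_field intro!: exI[of _ 0])
  qed simp
qed

end

end

theorem corollary3p3:
  fixes F :: "int \<Rightarrow> 'u::chilbert_space \<Rightarrow> 'y::chilbert_space"
    and H :: "complex \<Rightarrow> 'u \<Rightarrow> 'y"
    and A :: "'u \<Rightarrow> (nat, 'y) ell2"
  assumes "\<And>n::nat. n \<ge> 1 \<Longrightarrow> bounded_clinear (F (- int n))"
    and "\<And>u. summable (\<lambda>n. (norm (F (- int (Suc n)) u))\<^sup>2)"
    and "A = truncated_hankel F"
    and "contraction A"
    and "H \<in> hardy2_op"
  shows "(one_complementary F (\<lambda>n u. taylor_coeff (\<lambda>z. H z u) n) \<longleftrightarrow>
           (\<exists>V \<in> schur_class (defect_space A) (UNIV \<times> defect_space A).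
              \<forall>z\<in>ball 0 1. \<forall>u.
                H z u = fst (V z (inv_into (defect_space A) (\<lambda>x. x - z *\<^sub>C snd (V z x)) (defect_op A u)))))
         \<and> (onorm A < 1 \<longrightarrow> defect_space A = UNIV)"
proof (intro conjI impI)
  let ?D = "defect_op A" and ?S = "defect_space A" and ?Hn = "\<lambda>n u. taylor_coeff (\<lambda>z. H z u) n"
  note A = assms(4)
  note S = closed_defect_space[of A] defect_space_subspace[OF A]
  have lin_H: "bounded_clinear (H z)" if "z \<in> ball 0 1" for z
    using assms(5) that by (simp add: hardy2_op_def)
  have H: "has_power_series (\<lambda>z. H z u) (\<lambda>n. ?Hn n u)" for u
  proof -
    have "disc_analytic (\<lambda>z. H z u)"
      using assms(5) by (simp add: hardy2_op_def hardy2_def disc_analytic_def)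
    then obtain a where a: "has_power_series (\<lambda>z. H z u) a" by (rule disc_analytic_has_power_series)
    then have "(\<lambda>n. ?Hn n u) = a" by (intro ext taylor_coeff_eq)
    with a show ?thesis by simp
  qed
  have compl: "one_complementary F ?Hn \<longleftrightarrow> (\<forall>n. bounded_clinear (?Hn n)) \<and>
      (\<forall>u. summable (\<lambda>n. (norm (?Hn n u))\<^sup>2) \<and> (\<Sum>n. (norm (?Hn n u))\<^sup>2) \<le> (norm (?D u))\<^sup>2)"
    unfolding assms(3)
    by (rule one_complementary_iff[OF _ _ A[unfolded assms(3)]]) (fact assms(1,2))+
  show "one_complementary F ?Hn \<longleftrightarrow> (\<exists>V \<in> schur_class ?S (UNIV \<times> ?S). \<forall>z\<in>ball 0 1. \<forall>u.
      H z u = fst (V z (inv_into ?S (\<lambda>x. x - z *\<^sub>C snd (V z x)) (?D u))))"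
  proof
    assume "one_complementary F ?Hn"
    then have lin_Hn: "\<And>n. bounded_clinear (?Hn n)"
      and summable: "\<And>u. summable (\<lambda>n. (norm (?Hn n u))\<^sup>2)"
      and le: "\<And>u. (\<Sum>n. (norm (?Hn n u))\<^sup>2) \<le> (norm (?D u))\<^sup>2"
      unfolding compl by auto
    define G where "G u = Abs_ell2 (\<lambda>n. ?Hn n u)" for u
    have Rep_G: "Rep_ell2 (G u) = (\<lambda>n. ?Hn n u)" for u
      unfolding G_def by (rule Rep_Abs_ell2[OF summable])
    have norm_G: "norm (G u) \<le> norm (?D u)" for u
      using le[of u] by (intro power2_le_imp_le[OF _ norm_ge_zero]) (simp add: norm_ell2_sq_suminf Rep_G)
    have norm_D: "norm (?D u) \<le> norm u" for u
      by (rule power2_le_imp_le) (simp_all add: norm_defect_op[OF A])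
    have lin_G: "bounded_clinear G"
    proof (rule bounded_clinearI[of _ 1])
      show "G (u + v) = G u + G v" for u v
        by (simp add: Rep_ell2_inject[symmetric] plus_ell2.rep_eq Rep_G bounded_clinear_add[OF lin_Hn])
      show "G (c *\<^sub>C u) = c *\<^sub>C G u" for c u
        by (simp add: Rep_ell2_inject[symmetric] scaleC_ell2.rep_eq Rep_G bounded_clinear_scaleC[OF lin_Hn])
      show "norm (G u) \<le> 1 * norm u" for u using order_trans[OF norm_G norm_D] by simp
    qed
    obtain \<Gamma> K where \<Gamma>: "bounded_clinear \<Gamma>" "bounded_clinear K"
      "\<And>x y. cinner (\<Gamma> x) y = cinner x (K y)" "\<And>x. norm (\<Gamma> x) \<le> norm x"
      "\<And>y. K y \<in> closure (range ?D)" "\<And>u. \<Gamma> (?D u) = G u"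
      using douglas_factorization[OF bounded_clinear_defect_op[OF A] lin_G norm_G] by blast
    interpret observable_system \<Gamma> K ell2_shift "\<lambda>x. Rep_ell2 x 0" ?S
      by unfold_locales
        (fact \<Gamma>(1-4) \<Gamma>(5)[folded defect_space_def] bounded_clinear_ell2_shift bounded_clinear_Rep_ell2
          ell2_shift_isometric S)+
    \<comment> \<open>Both sides generate the same coefficients: H by its Taylor series, the right
      side as the shift resolvent evaluated at \<Gamma> (D_A u) = G u.\<close>
    have "H z u = fst (V z (inv_into ?S (\<lambda>x. x - z *\<^sub>C snd (V z x)) (?D u)))"
      if z: "z \<in> ball 0 1" for z u
    proof (rule sums_unique2)
      show "(\<lambda>n. z ^ n *\<^sub>C ?Hn n u) sums H z u"
        using H[of u] z by (simp add: has_power_series_def)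
      show "(\<lambda>n. z ^ n *\<^sub>C ?Hn n u) sums
          fst (V z (inv_into ?S (\<lambda>x. x - z *\<^sub>C snd (V z x)) (?D u)))"
        unfolding transfer_function[OF z defect_op_in_defect_space] \<Gamma>(6)
        using resolvent_ell2_shift_sums[OF z, of "G u"] by (simp add: Rep_G)
    qed
    with V_schur_class show "\<exists>V \<in> schur_class ?S (UNIV \<times> ?S). \<forall>z\<in>ball 0 1. \<forall>u.
        H z u = fst (V z (inv_into ?S (\<lambda>x. x - z *\<^sub>C snd (V z x)) (?D u)))"
      by blast
  next
    assume "\<exists>V \<in> schur_class ?S (UNIV \<times> ?S). \<forall>z\<in>ball 0 1. \<forall>u.
        H z u = fst (V z (inv_into ?S (\<lambda>x. x - z *\<^sub>C snd (V z x)) (?D u)))"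
    then obtain V where V: "V \<in> schur_class ?S (UNIV \<times> ?S)"
      and HV: "\<And>z u. z \<in> ball 0 1 \<Longrightarrow>
        H z u = fst (V z (inv_into ?S (\<lambda>x. x - z *\<^sub>C snd (V z x)) (?D u)))"
      by blast
    interpret schur_function V ?S
      by unfold_locales (fact V S)+
    have bound: "(\<Sum>n<m. (norm (?Hn n u))\<^sup>2) \<le> (norm (?D u))\<^sup>2" for m u
      by (rule transfer_function_bound[OF defect_op_in_defect_space _ H])
        (simp add: HV h_def[OF defect_op_in_defect_space] N_def[abs_def])
    have summable: "summable (\<lambda>n. (norm (?Hn n u))\<^sup>2)" for u
      by (rule summableI_nonneg_bounded[OF _ bound]) simp
    have le: "(\<Sum>n. (norm (?Hn n u))\<^sup>2) \<le> (norm (?D u))\<^sup>2" for u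
      by (rule suminf_le_const[OF summable bound])
    \<comment> \<open>Linearity follows from that of each \<open>H z\<close> by uniqueness of Taylor
      coefficients. Boundedness follows because a single term is at most a partial sum, hence at
      most |D_A u|^2 \<le> |u|^2.\<close>
    have "bounded_clinear (?Hn n)" for n
    proof (rule bounded_clinearI[of _ 1])
      show "?Hn n (u + v) = ?Hn n u + ?Hn n v" for u v
      proof (rule taylor_coeff_eq[of _ "\<lambda>n. ?Hn n u + ?Hn n v"])
        show "has_power_series (\<lambda>z. H z (u + v)) (\<lambda>n. ?Hn n u + ?Hn n v)"
          using has_power_series_add[OF H[of u] H[of v]]
          by (rule has_power_series_cong[rotated]) (simp add: bounded_clinear_add[OF lin_H])
      qed
      show "?Hn n (c *\<^sub>C u) = c *\<^sub>C ?Hn n u" for c u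
      proof (rule taylor_coeff_eq[of _ "\<lambda>n. c *\<^sub>C ?Hn n u"])
        show "has_power_series (\<lambda>z. H z (c *\<^sub>C u)) (\<lambda>n. c *\<^sub>C ?Hn n u)"
          using has_power_series_scaleC[OF H[of u]]
          by (rule has_power_series_cong[rotated]) (simp add: bounded_clinear_scaleC[OF lin_H])
      qed
      show "norm (?Hn n u) \<le> 1 * norm u" for u
      proof -
        have "0 \<le> (\<Sum>k<n. (norm (?Hn k u))\<^sup>2)" by (simp add: sum_nonneg)
        then have "(norm (?Hn n u))\<^sup>2 \<le> (norm u)\<^sup>2"
          using bound[where m = "Suc n" and u = u] norm_defect_op[OF A, of u]
            zero_le_power2[of "norm (A u)"]
          unfolding sum.lessThan_Suc by linarith
        then show ?thesis using power2_le_imp_le[OF _ norm_ge_zero] by simp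
      qed
    qed
    then show "one_complementary F ?Hn"
      unfolding compl using summable le by blast
  qed
  show "?S = UNIV" if "onorm A < 1"
    using A that by (rule defect_space_strict_contraction)
qed

end
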